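(* Let $k$ be a field of characteristic zero which contains a primitive third root of unity, and equip $k(x,y)$ with the Poisson bracket determined by $\{y,x\}=yx$. Let $G$ be a finite subgroup of $SL_2(\mathbb{Z})$ acting on $k(x,y)$ by Poisson monomial automorphisms. Then there exists an isomorphism of Poisson algebras $k(x,y)^G \cong k(x,y)$.
   Context: $k(x,y)$ is the field of rational functions in two commuting variables; the bracket $\{y,x\}=yx$ extends uniquely to $k(x,y)$. $SL_2(\mathbb{Z})$ acts on $k(x,y)$ by Poisson automorphisms via $$g.y = y^ax^c,\quad g.x = y^bx^d,\qquad g=\begin{pmatrix} a&b\\c&d\end{pmatrix}\in SL_2(\mathbb{Z});$$ automorphisms arising this way are called Poisson monomial automorphisms. The fixed field $k(x,y)^G$ is closed under the bracket and so is a Poisson algebra by restriction. An isomorphism of Poisson algebras is a $k$-algebra isomorphism preserving Poisson brackets. *)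

theory Defs
  imports
    "HOL-Analysis.Determinants"
    "HOL-Algebra.Group"
    "HOL-Computational_Algebra.Polynomial_Factorial"
begin

section \<open>The field of rational functions in two variables\<close>

text \<open>\<open>k(x,y)\<close> is the fraction field of \<open>k[x][y]\<close>: the inner polynomial variable is \<open>x\<close>, the
  outer one is \<open>y\<close>.\<close>

type_synonym 'a ratfun2 = "'a poly poly fract"

definition ratconst :: "'a::field \<Rightarrow> 'a ratfun2" where
  "ratconst c = to_fract [:[:c:]:]"

definition ratX :: "'a::field ratfun2" where
  "ratX = to_fract [:[:0, 1:]:]"

definition ratY :: "'a::field ratfun2" where
  "ratY = to_fract [:0, 1:]"

definition primitive_root_of_unity :: "nat \<Rightarrow> 'a::field \<Rightarrow> bool" where
  "primitive_root_of_unity n z \<longleftrightarrow> n > 0 \<and> z ^ n = 1 \<and> (\<forall>m. 0 < m \<and> m < n \<longrightarrow> z ^ m \<noteq> 1)"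


section \<open>The Poisson bracket\<close>

definition poisson_bracket :: "('a::field ratfun2 \<Rightarrow> 'a ratfun2 \<Rightarrow> 'a ratfun2) \<Rightarrow> bool" where
  "poisson_bracket br \<longleftrightarrow>
     (\<forall>f g h. br (f + g) h = br f h + br g h) \<and>
     (\<forall>f g h. br f (g + h) = br f g + br f h) \<and>
     (\<forall>c f g. br (ratconst c * f) g = ratconst c * br f g) \<and>
     (\<forall>c f g. br f (ratconst c * g) = ratconst c * br f g) \<and>
     (\<forall>f. br f f = 0) \<and>
     (\<forall>f g h. br f (br g h) + br g (br h f) + br h (br f g) = 0) \<and>
     (\<forall>f g h. br f (g * h) = br f g * h + g * br f h)"

text \<open>Existence and uniqueness are proved in \<open>poisson_br_ex1\<close> below.\<close>

definition poisson_br :: "'a::field ratfun2 \<Rightarrow> 'a ratfun2 \<Rightarrow> 'a ratfun2" where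
  "poisson_br = (THE br. poisson_bracket br \<and> br ratY ratX = ratY * ratX)"

definition poisson_subalgebra :: "'a::field ratfun2 set \<Rightarrow> bool" where
  "poisson_subalgebra A \<longleftrightarrow>
     range ratconst \<subseteq> A \<and>
     (\<forall>f\<in>A. \<forall>g\<in>A. f + g \<in> A \<and> f * g \<in> A \<and> poisson_br f g \<in> A)"

definition poisson_alg_iso ::
    "'a::field ratfun2 set \<Rightarrow> 'a ratfun2 set \<Rightarrow> ('a ratfun2 \<Rightarrow> 'a ratfun2) \<Rightarrow> bool" where
  "poisson_alg_iso A B \<phi> \<longleftrightarrow>
     poisson_subalgebra A \<and> poisson_subalgebra B \<and> bij_betw \<phi> A B \<and>
     (\<forall>c. \<phi> (ratconst c) = ratconst c) \<and>
     (\<forall>f\<in>A. \<forall>g\<in>A. \<phi> (f + g) = \<phi> f + \<phi> g \<and> \<phi> (f * g) = \<phi> f * \<phi> g \<and>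
        \<phi> (poisson_br f g) = poisson_br (\<phi> f) (\<phi> g))"


section \<open>Monomial automorphisms\<close>

definition SL2Z :: "(int^2^2) monoid" where
  "SL2Z = \<lparr>carrier = {g. det g = 1}, monoid.mult = (**), one = mat 1\<rparr>"

definition alg_endo :: "('a::field ratfun2 \<Rightarrow> 'a ratfun2) \<Rightarrow> bool" where
  "alg_endo \<phi> \<longleftrightarrow>
     (\<forall>f g. \<phi> (f + g) = \<phi> f + \<phi> g) \<and> (\<forall>f g. \<phi> (f * g) = \<phi> f * \<phi> g) \<and>
     (\<forall>c. \<phi> (ratconst c) = ratconst c)"

text \<open>For \<open>det g \<noteq> 0\<close> existence and uniqueness are proved in \<open>monomial_aut_ex1\<close> below.\<close>

definition monomial_aut :: "int^2^2 \<Rightarrow> 'a::field ratfun2 \<Rightarrow> 'a ratfun2" where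
  "monomial_aut g = (THE \<phi>. alg_endo \<phi> \<and>
     \<phi> ratY = ratY powi (g$1$1) * ratX powi (g$2$1) \<and>
     \<phi> ratX = ratY powi (g$1$2) * ratX powi (g$2$2))"

definition fixed_field :: "(int^2^2) set \<Rightarrow> 'a::field ratfun2 set" where
  "fixed_field G = {f. \<forall>g\<in>G. monomial_aut g f = f}"

section \<open>Well-definedness\<close>

lemma group_SL2Z: "group SL2Z"
proof (rule groupI)
  fix g assume g: "g \<in> carrier SL2Z"
  define h :: "int^2^2" where
    "h = (\<chi> i j. if i = 1 then (if j = 1 then g$2$2 else - g$1$2)
                         else (if j = 1 then - g$2$1 else g$1$1))"
  have "det h = 1" "h ** g = mat 1"
    using g by (auto simp: SL2Z_def h_def det_2 vec_eq_iff forall_2 matrix_matrix_mult_def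
        sum_2 mat_def algebra_simps)
  then show "\<exists>h\<in>carrier SL2Z. h \<otimes>\<^bsub>SL2Z\<^esub> g = \<one>\<^bsub>SL2Z\<^esub>"
    by (auto simp: SL2Z_def)
qed (auto simp: SL2Z_def det_mul matrix_mul_assoc)

lemma rat_simps:
  "ratconst 0 = 0" "ratconst 1 = 1"
  "ratconst (c + d) = ratconst c + ratconst d"
  "ratconst (c * d) = ratconst c * ratconst d"
  by (simp_all add: ratconst_def flip: to_fract_add to_fract_mult one_pCons)

lemma ratX_nz [simp]: "ratX \<noteq> 0" and ratY_nz [simp]: "ratY \<noteq> 0"
  by (simp_all add: ratX_def ratY_def)

lemma poly_poly_induct [case_names const X Y add mult]:
  fixes p :: "'a::field poly poly"
  assumes "\<And>c. P [:[:c:]:]" "P [:[:0, 1:]:]" "P [:0, 1:]"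
    and "\<And>p q. P p \<Longrightarrow> P q \<Longrightarrow> P (p + q)" "\<And>p q. P p \<Longrightarrow> P q \<Longrightarrow> P (p * q)"
  shows "P p"
proof -
  have inner: "P [:q:]" for q
  proof (induction q)
    case 0 then show ?case using assms(1)[of 0] by simp
  next
    case (pCons a q)
    have "[:pCons a q:] = [:[:a:]:] + [:[:0, 1:]:] * [:q:]" by simp
    then show ?case using assms pCons by metis
  qed
  show ?thesis
  proof (induction p)
    case 0 then show ?case using assms(1)[of 0] by simp
  next
    case (pCons a p)
    have "pCons a p = [:a:] + [:0, 1:] * p" by simp
    then show ?case using assms pCons inner by metis
  qed
qed

lemma map_poly_plus:
  assumes "f 0 = 0" "\<And>a b. f (a + b) = f a + f b"
  shows "map_poly f (p + q) = map_poly f p + map_poly f q"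
  using assms by (simp add: poly_eq_iff coeff_map_poly)

lemma fract_to_fract_cases:
  fixes f :: "'a::idom fract"
  obtains a b where "f = to_fract a / to_fract b" "b \<noteq> 0"
  by (metis Fract_cases Fract_conv_to_fract)

text \<open>Ring homomorphisms and derivations of an integral domain extend to its fraction field.\<close>

lemma hom_extends:
  fixes h :: "'p::idom \<Rightarrow> 'f::field"
  assumes add: "\<And>p q. h (p + q) = h p + h q" and mult: "\<And>p q. h (p * q) = h p * h q"
    and one: "h 1 = 1" and nz: "\<And>p. p \<noteq> 0 \<Longrightarrow> h p \<noteq> 0"
  obtains H where "\<And>f g. H (f + g) = H f + H g" "\<And>f g. H (f * g) = H f * H g"
    "\<And>p. H (to_fract p) = h p"
proof -
  have wd: "h a / h b = h c / h d"
    if "to_fract a / to_fract b = to_fract c / to_fract d" "b \<noteq> 0" "d \<noteq> 0" for a b c d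
  proof -
    have "to_fract (a * d) = to_fract (c * b)"
      using that by (simp add: divide_simps)
    then have "h (a * d) = h (c * b)" by (simp only: to_fract_eq_iff)
    then show ?thesis using that nz by (simp add: mult divide_simps)
  qed
  define H where "H f = (SOME r. \<exists>a b. f = to_fract a / to_fract b \<and> b \<noteq> 0 \<and> r = h a / h b)" for f
  have H: "H (to_fract a / to_fract b) = h a / h b" if "b \<noteq> 0" for a b
  proof -
    let ?P = "\<lambda>r. \<exists>a' b'. to_fract a / to_fract b = to_fract a' / to_fract b' \<and> b' \<noteq> 0 \<and> r = h a' / h b'"
    have "?P (h a / h b)" using that by blast
    then have "?P (H (to_fract a / to_fract b))" unfolding H_def by (rule someI)
    then obtain a' b' where e: "to_fract a / to_fract b = to_fract a' / to_fract b'" "b' \<noteq> 0"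
      and v: "H (to_fract a / to_fract b) = h a' / h b'" by blast
    show ?thesis unfolding v by (rule wd[OF e(1) that e(2), symmetric])
  qed
  show ?thesis
  proof (rule that)
    fix f g :: "'p fract"
    obtain a b where f: "f = to_fract a / to_fract b" "b \<noteq> 0" by (rule fract_to_fract_cases)
    obtain c d where g: "g = to_fract c / to_fract d" "d \<noteq> 0" by (rule fract_to_fract_cases)
    have *: "f + g = to_fract (a * d + c * b) / to_fract (b * d)"
      "f * g = to_fract (a * c) / to_fract (b * d)"
      unfolding f(1) g(1) using f(2) g(2) by (simp_all add: divide_simps)
    have nz': "b * d \<noteq> 0" "h b \<noteq> 0" "h d \<noteq> 0" using f(2) g(2) nz by simp_all
    show "H (f + g) = H f + H g"
      unfolding *(1) H[OF nz'(1)] unfolding f(1) g(1) H[OF f(2)] H[OF g(2)]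
      using nz' by (simp add: add mult divide_simps)
    show "H (f * g) = H f * H g"
      unfolding *(2) H[OF nz'(1)] unfolding f(1) g(1) H[OF f(2)] H[OF g(2)]
      using nz' by (simp add: mult)
  next
    fix p
    show "H (to_fract p) = h p" using H[of 1 p] one by simp
  qed
qed

lemma deriv_extends:
  fixes d :: "'p::idom \<Rightarrow> 'p"
  assumes add: "\<And>p q. d (p + q) = d p + d q" and mult: "\<And>p q. d (p * q) = d p * q + p * d q"
  obtains D where "\<And>f g. D (f + g) = D f + D g" "\<And>f g. D (f * g) = D f * g + f * D g"
    "\<And>p. D (to_fract p) = to_fract (d p)"
proof -
  let ?r = "\<lambda>a b. to_fract (d a * b - a * d b) / to_fract (b * b)"
  have wd: "?r a b = ?r a' b'"
    if "to_fract a / to_fract b = to_fract a' / to_fract b'" and nz: "b \<noteq> 0" "b' \<noteq> 0" for a b a' b'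
  proof -
    have "to_fract (a * b') = to_fract (a' * b)"
      using that by (simp add: divide_simps)
    then have e: "a * b' = a' * b" by (simp only: to_fract_eq_iff)
    then have "d (a * b') = d (a' * b)" by simp
    then have e2: "d a * b' + a * d b' = d a' * b + a' * d b" by (simp add: mult)
    have "(d a * b - a * d b) * (b' * b') - (d a' * b' - a' * d b') * (b * b)
       = b * b' * ((d a * b' + a * d b') - (d a' * b + a' * d b))
         - (a * b' - a' * b) * (d b * b' + b * d b')"
      by (simp add: algebra_simps)
    also have "\<dots> = 0" using e e2 by simp
    finally have "(d a * b - a * d b) * (b' * b') = (d a' * b' - a' * d b') * (b * b)" by simp
    then have "to_fract ((d a * b - a * d b) * (b' * b')) = to_fract ((d a' * b' - a' * d b') * (b * b))"
      by (rule arg_cong)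
    then have "to_fract (d a * b - a * d b) * to_fract (b' * b') = to_fract (d a' * b' - a' * d b') * to_fract (b * b)"
      by (simp only: to_fract_mult)
    moreover have "to_fract (b * b) \<noteq> 0" "to_fract (b' * b') \<noteq> 0" using nz by auto
    ultimately show ?thesis by (metis frac_eq_eq)
  qed
  define D where "D f = (SOME r. \<exists>a b. f = to_fract a / to_fract b \<and> b \<noteq> 0 \<and> r = ?r a b)" for f
  have D: "D (to_fract a / to_fract b) = ?r a b" if "b \<noteq> 0" for a b
  proof -
    let ?P = "\<lambda>r. \<exists>a' b'. to_fract a / to_fract b = to_fract a' / to_fract b' \<and> b' \<noteq> 0 \<and> r = ?r a' b'"
    have "?P (?r a b)" using that by blast
    then have "?P (D (to_fract a / to_fract b))" unfolding D_def by (rule someI)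
    then obtain a' b' where e: "to_fract a / to_fract b = to_fract a' / to_fract b'" "b' \<noteq> 0"
      and v: "D (to_fract a / to_fract b) = ?r a' b'" by blast
    show ?thesis unfolding v by (rule wd[OF e(1) that e(2), symmetric])
  qed
  have d1: "d 1 = 0" using mult[of 1 1] by (metis add_cancel_right_right mult_1 mult_1_right)
  show ?thesis
  proof (rule that)
    fix f g :: "'p fract"
    obtain a b where f: "f = to_fract a / to_fract b" "b \<noteq> 0" by (rule fract_to_fract_cases)
    obtain a' b' where g: "g = to_fract a' / to_fract b'" "b' \<noteq> 0" by (rule fract_to_fract_cases)
    have *: "f + g = to_fract (a * b' + a' * b) / to_fract (b * b')"
         "f * g = to_fract (a * a') / to_fract (b * b')"
      unfolding f(1) g(1) using f(2) g(2) by (simp_all add: divide_simps)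
    have nz: "b * b' \<noteq> 0" using f g by simp
    show "D (f + g) = D f + D g"
      unfolding *(1) D[OF nz] unfolding f(1) g(1) D[OF f(2)] D[OF g(2)]
      using f(2) g(2) by (simp add: add mult divide_simps) (simp add: algebra_simps)
    show "D (f * g) = D f * g + f * D g"
      unfolding *(2) D[OF nz] unfolding f(1) g(1) D[OF f(2)] D[OF g(2)]
      using f(2) g(2) by (simp add: add mult divide_simps) (simp add: algebra_simps)
  next
    fix p
    show "D (to_fract p) = to_fract (d p)" using D[of 1 p] d1 by simp
  qed
qed

text \<open>Derivations, and homomorphisms, are determined by their values on constants, \<open>x\<close> and \<open>y\<close>.\<close>

lemma deriv_ext_fract:
  fixes D E :: "'p::idom fract \<Rightarrow> 'p fract"
  assumes D: "\<And>f g. D (f * g) = D f * g + f * D g"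
    and E: "\<And>f g. E (f * g) = E f * g + f * E g"
    and eq: "\<And>p. D (to_fract p) = E (to_fract p)"
  shows "D f = E f"
proof -
  obtain a b where f: "f = to_fract a / to_fract b" "b \<noteq> 0" by (rule fract_to_fract_cases)
  then have "f * to_fract b = to_fract a" by simp
  then have "D f * to_fract b + f * D (to_fract b) = E f * to_fract b + f * E (to_fract b)"
    using D E eq by metis
  then show ?thesis using eq f(2) by simp
qed

lemma deriv_ext:
  fixes D E :: "'a::field ratfun2 \<Rightarrow> 'a ratfun2"
  assumes D: "\<And>f g. D (f + g) = D f + D g" "\<And>f g. D (f * g) = D f * g + f * D g"
    and E: "\<And>f g. E (f + g) = E f + E g" "\<And>f g. E (f * g) = E f * g + f * E g"
    and eq: "\<And>c. D (ratconst c) = E (ratconst c)" "D ratX = E ratX" "D ratY = E ratY"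
  shows "D = E"
proof (rule ext, rule deriv_ext_fract[OF D(2) E(2)])
  fix p show "D (to_fract p) = E (to_fract p)"
    by (induction p rule: poly_poly_induct)
       (use eq in \<open>simp_all add: D E ratconst_def ratX_def ratY_def\<close>)
qed

lemma alg_endo_ext:
  fixes D E :: "'a::field ratfun2 \<Rightarrow> 'a ratfun2"
  assumes D: "alg_endo D" and E: "alg_endo E" and eq: "D ratX = E ratX" "D ratY = E ratY"
  shows "D = E"
proof
  fix f :: "'a ratfun2"
  have poly: "D (to_fract p) = E (to_fract p)" for p
    by (induction p rule: poly_poly_induct)
       (use eq D E in \<open>simp_all add: alg_endo_def ratconst_def ratX_def ratY_def\<close>)
  obtain a b where f: "f = to_fract a / to_fract b" "b \<noteq> 0" by (rule fract_to_fract_cases)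
  then have "f * to_fract b = to_fract a" by simp
  then have *: "D f * D (to_fract b) = E f * D (to_fract b)"
    using D E poly unfolding alg_endo_def by metis
  have "to_fract b * inverse (to_fract b) = ratconst 1" using f(2) by (simp add: rat_simps)
  then have "D (to_fract b) * D (inverse (to_fract b)) = 1"
    using D unfolding alg_endo_def by (metis rat_simps(2))
  then have "D (to_fract b) \<noteq> 0" by auto
  then show "D f = E f" using * by simp
qed

lemma log_derivs:
  obtains E F :: "'a::field ratfun2 \<Rightarrow> 'a ratfun2" where
    "\<And>f g. E (f + g) = E f + E g" "\<And>f g. E (f * g) = E f * g + f * E g"
    "\<And>f g. F (f + g) = F f + F g" "\<And>f g. F (f * g) = F f * g + f * F g"
    "\<And>c. E (ratconst c) = 0" "E ratX = ratX" "E ratY = 0"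
    "\<And>c. F (ratconst c) = 0" "F ratX = 0" "F ratY = ratY"
    "\<And>f. E (F f) = F (E f)"
proof -
  let ?d = "map_poly pderiv :: 'a poly poly \<Rightarrow> _"
  have d_pCons: "?d (pCons a p) = pCons (pderiv a) (?d p)" for a p
    by (simp add: map_poly_pCons)
  have d_add: "?d (p + q) = ?d p + ?d q" for p q
    by (simp add: poly_eq_iff coeff_map_poly pderiv_add)
  have d_smult: "?d (smult c p) = smult (pderiv c) p + smult c (?d p)" for c p
    by (simp add: poly_eq_iff coeff_map_poly pderiv_mult algebra_simps)
  have d_mult: "?d (p * q) = ?d p * q + p * ?d q" for p q
    by (induction p) (simp_all add: d_pCons d_add d_smult algebra_simps)
  obtain E where E: "\<And>f g. E (f + g) = E f + E g" "\<And>f g. E (f * g) = E f * g + f * E g"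
    "\<And>p. E (to_fract p) = to_fract ([:[:0, 1:]:] * ?d p)"
    by (rule deriv_extends[of "\<lambda>p. [:[:0, 1:]:] * ?d p"]) (auto simp only: d_add d_mult algebra_simps)
  obtain F where F: "\<And>f g. F (f + g) = F f + F g" "\<And>f g. F (f * g) = F f * g + f * F g"
    "\<And>p :: 'a poly poly. F (to_fract p) = to_fract ([:0, 1:] * pderiv p)"
    by (rule deriv_extends[of "\<lambda>p. [:0, 1:] * pderiv p"]) (auto simp only: pderiv_add pderiv_mult algebra_simps)
  have vals: "E (ratconst c) = 0" "E ratX = ratX" "E ratY = 0"
    "F (ratconst c) = 0" "F ratX = 0" "F ratY = ratY" for c
    by (simp_all add: ratconst_def ratX_def ratY_def E F d_pCons pderiv_pCons)
  have E0: "E 0 = 0" and F0: "F 0 = 0" using E(1)[of 0 0] F(1)[of 0 0]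
    by (metis add_0 add_cancel_right_right)+
  have Em: "E (- f) = - E f" and Fm: "F (- f) = - F f" for f
    using E(1)[of f "-f"] F(1)[of f "-f"] E0 F0 by (auto simp: eq_neg_iff_add_eq_0 add.commute)
  have Z: "(\<lambda>f. E (F f) - F (E f)) = (\<lambda>f. 0)"
    by (rule deriv_ext) (auto simp: E F vals E0 F0 algebra_simps)
  have "E (F f) = F (E f)" for f using fun_cong[OF Z, of f] by simp
  with E F vals show ?thesis using that by blast
qed

theorem poisson_br_ex1:
  "\<exists>!br :: 'a::field ratfun2 \<Rightarrow> _. poisson_bracket br \<and> br ratY ratX = ratY * ratX"
proof (rule log_derivs[where 'a = 'a])
  fix E F :: "'a ratfun2 \<Rightarrow> 'a ratfun2"
  assume
    E: "\<And>f g. E (f + g) = E f + E g" "\<And>f g. E (f * g) = E f * g + f * E g" and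
    F: "\<And>f g. F (f + g) = F f + F g" "\<And>f g. F (f * g) = F f * g + f * F g" and
    v: "\<And>c. E (ratconst c) = 0" "E ratX = ratX" "E ratY = 0"
       "\<And>c. F (ratconst c) = 0" "F ratX = 0" "F ratY = ratY" and
    c: "\<And>f. E (F f) = F (E f)"
  have Em: "E (f - g) = E f - E g" and Fm: "F (f - g) = F f - F g" for f g
    using E(1)[of "f - g" g] F(1)[of "f - g" g] by (simp_all add: algebra_simps)
  have "poisson_bracket (\<lambda>f g. F f * E g - E f * F g)"
    unfolding poisson_bracket_def by (auto simp: E F v c Em Fm algebra_simps)
  moreover have "F ratY * E ratX - E ratY * F ratX = ratY * ratX" by (simp add: v)
  moreover have "br = br'" if br: "poisson_bracket br" "br ratY ratX = ratY * ratX"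
    and br': "poisson_bracket br'" "br' ratY ratX = ratY * ratX"
    for br br' :: "'a ratfun2 \<Rightarrow> 'a ratfun2 \<Rightarrow> 'a ratfun2"
  proof -
    have const: "b f (ratconst c) = 0" if "poisson_bracket b" for b :: "'a ratfun2 \<Rightarrow> _" and f c
    proof -
      have "b f (1 * 1) = b f 1 * 1 + 1 * b f 1" using that unfolding poisson_bracket_def by metis
      then have "b f 1 = 0" by (metis add_cancel_right_right mult_1 mult_1_right)
      moreover have "b f (ratconst c * 1) = ratconst c * b f 1"
        using that unfolding poisson_bracket_def by metis
      ultimately show ?thesis by simp
    qed
    have anti: "b f g = - b g f" if "poisson_bracket b" for b :: "'a ratfun2 \<Rightarrow> _" and f g
    proof -
      have "b (f + g) (f + g) = b f f + b f g + (b g f + b g g)" "b (f + g) (f + g) = 0"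
        "b f f = 0" "b g g = 0"
        using that unfolding poisson_bracket_def by metis+
      then show ?thesis by (simp add: eq_neg_iff_add_eq_0)
    qed
    have ext: "br f = br' f" if "br f ratX = br' f ratX" "br f ratY = br' f ratY" for f
      by (rule deriv_ext)
         (use br br' that in \<open>auto simp: const\<close>, (simp_all add: poisson_bracket_def))
    have self: "br f f = 0" "br' f f = 0" for f
      using br br' by (auto simp: poisson_bracket_def)
    have Y: "br ratY = br' ratY" by (rule ext) (use br br' self in auto)
    have X: "br ratX = br' ratX"
      by (rule ext) (use br br' self anti[OF br(1), of ratX ratY] anti[OF br'(1), of ratX ratY] in auto)
    have "br f = br' f" for f
      by (rule ext) (simp_all add: anti[OF br(1), of f] anti[OF br'(1), of f] X Y)
    then show ?thesis by blast
  qed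
  ultimately show ?thesis by (intro ex1I[of _ "\<lambda>f g. F f * E g - E f * F g"]) auto
qed

text \<open>Distinct monomials have distinct images under an exponent matrix of nonzero determinant.\<close>

lemma monomial_eval_nonzero:
  fixes p :: "'a::field poly poly" and a b c d :: int
  assumes p: "p \<noteq> 0" and det: "a * d - b * c \<noteq> 0"
  defines "U \<equiv> ratY powi a * ratX powi c" and "V \<equiv> ratY powi b * ratX powi d"
  shows "(\<Sum>j\<le>degree p. (\<Sum>i\<le>degree (coeff p j). ratconst (coeff (coeff p j) i) * V ^ i) * U ^ j) \<noteq> 0"
    (is "?S \<noteq> 0")
proof
  assume S: "?S = 0"
  define J where "J = Sigma {..degree p} (\<lambda>j. {..degree (coeff p j)})"
  define u where "u = (\<lambda>(j::nat, i::nat). a * int j + b * int i)"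
  define v where "v = (\<lambda>(j::nat, i::nat). c * int j + d * int i)"
  have fin: "finite J" by (simp add: J_def)
  define N where "N = (\<Sum>t\<in>J. \<bar>u t\<bar> + \<bar>v t\<bar>)"
  have N: "0 \<le> N + u t" "0 \<le> N + v t" if "t \<in> J" for t
  proof -
    have "\<bar>u t\<bar> + \<bar>v t\<bar> \<le> N" unfolding N_def by (rule member_le_sum) (use that fin in auto)
    then show "0 \<le> N + u t" "0 \<le> N + v t" by linarith+
  qed
  let ?c = "\<lambda>t. coeff (coeff p (fst t)) (snd t)"
  have S': "?S = (\<Sum>t\<in>J. ratconst (?c t) * (ratY powi (u t) * ratX powi (v t)))"
    unfolding J_def sum_distrib_right
    by (subst sum.Sigma)
       (auto intro!: sum.cong simp: u_def v_def U_def V_def power_mult_distrib power_int_add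
           power_int_mult algebra_simps)
  define Q where "Q = (\<Sum>t\<in>J. monom (monom (?c t) (nat (N + v t))) (nat (N + u t)))"
  have X: "ratX ^ n = to_fract [:monom (1::'a) n:]" and Y: "ratY ^ n = to_fract (monom (1::'a poly) n)" for n
    by (induction n; simp add: ratX_def ratY_def monom_Suc flip: to_fract_mult one_pCons)+
  have mono: "ratY powi N * ratX powi N * (ratconst (?c t) * (ratY powi (u t) * ratX powi (v t)))
      = to_fract (monom (monom (?c t) (nat (N + v t))) (nat (N + u t)))" if "t \<in> J" for t
  proof -
    have "ratY powi N * ratX powi N * (ratconst (?c t) * (ratY powi (u t) * ratX powi (v t)))
      = ratconst (?c t) * (ratY powi (N + u t) * ratX powi (N + v t))"
      by (simp add: power_int_add)
    also have "\<dots> = ratconst (?c t) * (ratY ^ nat (N + u t) * ratX ^ nat (N + v t))"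
      using N[OF that] by (simp add: power_int_def)
    also have "\<dots> = to_fract (monom (monom (?c t) (nat (N + v t))) (nat (N + u t)))"
      unfolding X Y ratconst_def
      by (simp add: smult_monom mult.commute flip: to_fract_mult)
    finally show ?thesis .
  qed
  have "to_fract Q = (\<Sum>t\<in>J. to_fract (monom (monom (?c t) (nat (N + v t))) (nat (N + u t))))"
    unfolding Q_def using fin by (induction J rule: finite_induct) simp_all
  also have "\<dots> = ratY powi N * ratX powi N * ?S"
    unfolding S' sum_distrib_left by (rule sum.cong) (simp_all add: mono)
  finally have Q0: "Q = 0" using S by simp
  define t0 where "t0 = (degree p, degree (lead_coeff p))"
  have t0: "t0 \<in> J" by (simp add: t0_def J_def)
  have inj: "t = t0" if t: "t \<in> J" "nat (N + u t) = nat (N + u t0)" "nat (N + v t) = nat (N + v t0)" for t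
  proof -
    obtain j i j0 i0 where tt: "t = (j, i)" "t0 = (j0, i0)" by fastforce
    have "u t = u t0" "v t = v t0" using t N[OF t(1)] N[OF t0] by (auto simp: nat_eq_iff)
    then have e: "a * (int j - int j0) + b * (int i - int i0) = 0" "c * (int j - int j0) + d * (int i - int i0) = 0"
      by (simp_all add: tt u_def v_def algebra_simps)
    have "(a * d - b * c) * (int j - int j0) = d * (a * (int j - int j0) + b * (int i - int i0))
        - b * (c * (int j - int j0) + d * (int i - int i0))"
      "(a * d - b * c) * (int i - int i0) = a * (c * (int j - int j0) + d * (int i - int i0))
        - c * (a * (int j - int j0) + b * (int i - int i0))"
      by (simp_all add: algebra_simps)
    then have "(a * d - b * c) * (int j - int j0) = 0" "(a * d - b * c) * (int i - int i0) = 0"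
      using e by simp_all
    then show ?thesis using det by (simp add: tt)
  qed
  have "coeff (coeff Q (nat (N + u t0))) (nat (N + v t0))
      = (\<Sum>t\<in>J. if t = t0 then ?c t else 0)"
    unfolding Q_def coeff_sum by (rule sum.cong) (auto simp: dest: inj)
  also have "\<dots> = ?c t0" using fin t0 by simp
  also have "\<dots> \<noteq> 0" using p by (simp add: t0_def)
  finally show False using Q0 by simp
qed

theorem monomial_aut_ex1:
  fixes g :: "int^2^2"
  assumes "det g \<noteq> 0"
  shows "\<exists>!\<phi> :: 'a::field ratfun2 \<Rightarrow> _. alg_endo \<phi> \<and>
     \<phi> ratY = ratY powi (g$1$1) * ratX powi (g$2$1) \<and>
     \<phi> ratX = ratY powi (g$1$2) * ratX powi (g$2$2)"
proof -
  define U V :: "'a ratfun2" where "U = ratY powi (g$1$1) * ratX powi (g$2$1)"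
    and "V = ratY powi (g$1$2) * ratX powi (g$2$2)"
  define e where "e q = poly (map_poly ratconst q) V" for q
  define h where "h p = poly (map_poly e p) U" for p
  have e0: "e 0 = 0" by (simp add: e_def)
  have e_pCons: "e (pCons c q) = ratconst c + V * e q" for c q
    by (simp add: e_def map_poly_pCons rat_simps)
  have e_add: "e (p + q) = e p + e q" for p q
    unfolding e_def by (subst map_poly_plus) (simp_all add: rat_simps)
  have h0: "h 0 = 0" by (simp add: h_def)
  have h_pCons: "h (pCons c p) = e c + U * h p" for c p
    by (simp add: h_def map_poly_pCons e0)
  have e_smult: "e (smult c p) = ratconst c * e p" for c p
    by (induction p) (simp_all add: e0 e_pCons rat_simps algebra_simps)
  have e_mult: "e (p * q) = e p * e q" for p q
    by (induction p) (simp_all add: e0 e_pCons e_add e_smult rat_simps algebra_simps)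
  have h_add: "h (p + q) = h p + h q" for p q
    unfolding h_def by (subst map_poly_plus) (simp_all add: e0 e_add)
  have h_smult: "h (smult c p) = e c * h p" for c p
    by (induction p) (simp_all add: h0 h_pCons e_mult algebra_simps)
  have h_mult: "h (p * q) = h p * h q" for p q
    by (induction p) (simp_all add: h0 h_pCons h_add h_smult e0 algebra_simps)
  have e1: "e 1 = 1" by (simp add: one_pCons e_pCons e0 rat_simps)
  have h1: "h 1 = 1" by (simp add: one_pCons h_pCons e_pCons h0 e0 rat_simps)
  have poly_alt: "poly (map_poly f r) x = (\<Sum>i\<le>degree r. f (coeff r i) * x ^ i)"
    if "f 0 = 0" for f :: "'b::zero \<Rightarrow> 'a ratfun2" and r x
  proof -
    have "poly (map_poly f r) x = (\<Sum>i\<le>degree r. coeff (map_poly f r) i * x ^ i)"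
      unfolding poly_altdef
    proof (rule sum.mono_neutral_left)
      have "degree (map_poly f r) \<le> degree r"
        by (rule degree_le) (simp add: coeff_map_poly that coeff_eq_0)
      then show "{..degree (map_poly f r)} \<subseteq> {..degree r}" by simp
    qed (auto simp: coeff_eq_0)
    then show ?thesis using that by (simp add: coeff_map_poly)
  qed
  have "h p \<noteq> 0" if "p \<noteq> 0" for p
    using monomial_eval_nonzero[OF that, of "g$1$1" "g$2$2" "g$1$2" "g$2$1"] assms
    unfolding h_def e_def U_def V_def
    by (simp add: poly_alt rat_simps det_2)
  then obtain H where H: "\<And>f g. H (f + g) = H f + H g" "\<And>f g. H (f * g) = H f * H g"
      "\<And>p. H (to_fract p) = h p"
    using hom_extends[of h] h_add h_mult h1 by metis
  have "alg_endo H" "H ratY = U" "H ratX = V"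
    by (simp_all add: alg_endo_def H ratconst_def ratX_def ratY_def h_pCons e_pCons e0 e1 h0)
       (simp_all add: rat_simps flip: ratconst_def)
  then show ?thesis
    unfolding U_def V_def by (intro ex1I[of _ H]) (auto intro: alg_endo_ext)
qed

end

theory Submission
  imports Defs
begin

text \<open>
A finite subgroup of \<open>SL\<^sub>2(\<int>)\<close> is, up to conjugation, cyclic of order 1, 2, 3, 4 or 6 and generated by
\<open>1\<close>, \<open>- 1\<close> or a companion matrix of small trace, possibly together with \<open>- 1\<close>. Conjugation does not
change the isomorphism type of the fixed field (\<open>finite_sl2_conj\<close>), so it suffices to treat these
groups.

For each of them the task is to find \<open>u\<close> and \<open>v\<close> that generate the fixed field and satisfy
\<open>{v, u} = v u\<close>; such a pair is algebraically independent, and \<open>x \<mapsto> u\<close>, \<open>y \<mapsto> v\<close> is then a Poisson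
isomorphism from \<open>k(x, y)\<close> onto the fixed field (\<open>log_poisson_pair_substitution\<close>, \<open>endo_poisson\<close>,
\<open>log_rational_iso\<close>). The generators come from geometry. In the three cases treated explicitly,
the invariant Laurent polynomials form the coordinate ring of a cubic surface, the form
\<open>dx \<and> dy / (x y)\<close> descends to it, and projecting the surface from a singular point or from a line
makes it rational with a form that can be made logarithmic by one more change of variables. That a given pair generates the full fixed field is
decided by a trace criterion (\<open>fixed_in_subfield\<close>).

Only three explicit pairs are needed: for the inversion \<open>x \<mapsto> 1/x\<close>, \<open>y \<mapsto> 1/y\<close>
(\<open>order2_generators\<close>), for its twist \<open>x \<mapsto> 1/x\<close>, \<open>y \<mapsto> - 1/y\<close> (\<open>twisted_involution_generators\<close>),
and for the automorphism of order three (\<open>order3_generators\<close>). Orders four and six are reached in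
two steps: the automorphism of order four acts on the generators for its square by the twisted
inversion, and the inversion acts on suitable generators for order three by inverting both
(\<open>tower_fixed\<close>). The cube root of unity enters in the choice of these generators.

On the arithmetic side, the elements of a finite subgroup other than \<open>1\<close> and \<open>- 1\<close> have trace \<open>- 1\<close>,
\<open>0\<close> or \<open>1\<close> (\<open>finite_sl2_elements\<close>); reduction theory conjugates such an element to a companion
matrix or its inverse (\<open>sl2_conj_companion\<close>); and a trace estimate shows that the companion matrix
and the scalars account for the whole group (\<open>companion_group\<close>).
\<close>

section \<open>Derivations and the Poisson bracket\<close>

definition is_derivation :: "('a::field ratfun2 \<Rightarrow> 'a ratfun2) \<Rightarrow> bool" where
  "is_derivation D \<longleftrightarrow> (\<forall>f g. D (f + g) = D f + D g) \<and>
     (\<forall>f g. D (f * g) = D f * g + f * D g) \<and> (\<forall>c. D (ratconst c) = 0)"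

lemma ratconst_numeral: "ratconst (numeral n) = numeral n"
proof -
  have "ratconst (of_nat k) = of_nat k" for k
    by (induction k) (simp_all add: rat_simps)
  from this[of "numeral n"] show ?thesis by simp
qed

context
  fixes D :: "'a::field ratfun2 \<Rightarrow> 'a ratfun2"
  assumes D: "is_derivation D"
begin

lemma deriv_add: "D (f + g) = D f + D g"
  and deriv_mult: "D (f * g) = D f * g + f * D g"
  and deriv_const: "D (ratconst c) = 0"
  using D by (auto simp: is_derivation_def)

lemma deriv_0: "D 0 = 0" and deriv_1: "D 1 = 0"
  using deriv_const[of 0] deriv_const[of 1] by (simp_all add: rat_simps)

lemma deriv_numeral: "D (numeral n) = 0"
  using deriv_const[of "numeral n"] by (simp add: ratconst_numeral)

lemma deriv_minus: "D (- f) = - D f"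
  using deriv_add[of f "- f"] by (simp add: deriv_0 eq_neg_iff_add_eq_0 add.commute)

lemma deriv_diff: "D (f - g) = D f - D g"
  using deriv_add[of f "- g"] by (simp add: deriv_minus)

lemma deriv_power: "D (f ^ n) = of_nat n * f ^ (n - 1) * D f"
proof (induction n)
  case (Suc n)
  then show ?case by (cases n) (simp_all add: deriv_mult deriv_1 algebra_simps)
qed (simp add: deriv_1)

lemma deriv_divide:
  assumes "g \<noteq> 0"
  shows "D (f / g) = (D f * g - f * D g) / g ^ 2"
proof -
  have "D f = D (f / g * g)" using assms by simp
  also have "\<dots> = D (f / g) * g + f / g * D g" by (rule deriv_mult)
  finally show ?thesis using assms by (simp add: field_simps power2_eq_square)
qed

lemmas deriv_simps = deriv_add deriv_mult deriv_const deriv_0 deriv_1 deriv_numeral deriv_minus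
  deriv_diff deriv_power

end

lemma poisson_bracket_br: "poisson_bracket poisson_br"
  and br_Y_X: "poisson_br ratY ratX = ratY * ratX"
  using theI'[OF poisson_br_ex1] by (auto simp: poisson_br_def)

lemma br_self: "poisson_br f f = 0" for f :: "'a::field ratfun2"
  using poisson_bracket_br[where 'a = 'a] by (simp add: poisson_bracket_def)

lemma br_anti: "poisson_br f g = - poisson_br g f"
proof -
  have "poisson_br (f + g) (f + g) = poisson_br f f + poisson_br g f + (poisson_br f g + poisson_br g g)"
    using poisson_bracket_br unfolding poisson_bracket_def by metis
  then show ?thesis by (simp add: br_self eq_neg_iff_add_eq_0 add.commute)
qed

lemma derivation_br_right: "is_derivation (poisson_br f)" for f :: "'a::field ratfun2"
proof -
  note br = poisson_bracket_br[where 'a = 'a]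
  have mult: "poisson_br f (g * h) = poisson_br f g * h + g * poisson_br f h" for g h
    using br by (simp add: poisson_bracket_def)
  have "poisson_br f 1 = 0"
    using mult[of 1 1] by (metis add_cancel_right_right mult_1 mult_1_right)
  moreover have "poisson_br f (ratconst c * 1) = ratconst c * poisson_br f 1" for c
    using br unfolding poisson_bracket_def by metis
  ultimately show ?thesis
    using mult br by (simp add: is_derivation_def poisson_bracket_def)
qed

lemma derivation_br_left: "is_derivation (\<lambda>f. poisson_br f g)"
proof -
  have "(\<lambda>f. poisson_br f g) = (\<lambda>f. - poisson_br g f)"
    by (rule ext) (rule br_anti)
  then show ?thesis
    using derivation_br_right[of g] by (simp add: is_derivation_def algebra_simps)
qed

text \<open>The Euler operators \<open>x \<partial>/\<partial>x\<close> and \<open>y \<partial>/\<partial>y\<close>. Expressing them through the bracket gives them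
their derivation properties at once, and conversely they make the bracket computable.\<close>

definition theta_x :: "'a::field ratfun2 \<Rightarrow> 'a ratfun2" where
  "theta_x f = poisson_br ratY f / ratY"

definition theta_y :: "'a::field ratfun2 \<Rightarrow> 'a ratfun2" where
  "theta_y f = poisson_br f ratX / ratX"

lemma derivation_theta_x: "is_derivation theta_x"
  unfolding is_derivation_def theta_x_def
  by (simp add: deriv_simps[OF derivation_br_right] field_simps)

lemma derivation_theta_y: "is_derivation theta_y"
  unfolding is_derivation_def theta_y_def
  by (simp add: deriv_simps[OF derivation_br_left] field_simps)

lemma theta_simps:
  "theta_x ratX = ratX" "theta_x ratY = 0" "theta_y ratX = 0" "theta_y ratY = ratY"
  by (simp_all add: theta_x_def theta_y_def br_Y_X br_self)

lemma derivation_ext: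
  assumes D: "is_derivation D" and E: "is_derivation E"
    and "D ratX = E ratX" "D ratY = E ratY"
  shows "D f = E f"
proof -
  have "D = E"
    by (rule deriv_ext) (use assms in \<open>auto simp: is_derivation_def\<close>)
  then show ?thesis by simp
qed

text \<open>Both sides are derivations in each argument, so the identity only has to be checked on \<open>x\<close> and
\<open>y\<close>. It says that the bracket is the one dual to the form \<open>dx \<and> dy / (x y)\<close>.\<close>

lemma br_theta: "poisson_br f g = theta_y f * theta_x g - theta_x f * theta_y g"
proof -
  have right: "is_derivation (\<lambda>g. theta_y f * theta_x g - theta_x f * theta_y g)" for f :: "'a ratfun2"
    unfolding is_derivation_def
    by (simp add: deriv_simps[OF derivation_theta_x] deriv_simps[OF derivation_theta_y] algebra_simps)
  have left: "is_derivation (\<lambda>f. theta_y f * theta_x g - theta_x f * theta_y g)" for g :: "'a ratfun2"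
    unfolding is_derivation_def
    by (simp add: deriv_simps[OF derivation_theta_x] deriv_simps[OF derivation_theta_y] algebra_simps)
  have X: "poisson_br f ratX = theta_y f * theta_x ratX - theta_x f * theta_y ratX" for f :: "'a ratfun2"
    by (rule derivation_ext[OF derivation_br_left left]) (simp_all add: theta_simps br_self br_Y_X)
  have Y: "poisson_br f ratY = theta_y f * theta_x ratY - theta_x f * theta_y ratY" for f :: "'a ratfun2"
    by (rule derivation_ext[OF derivation_br_left left])
       (simp_all add: theta_simps br_self br_anti[of ratX ratY] br_Y_X)
  show ?thesis
    by (rule derivation_ext[OF derivation_br_right right]) (simp_all add: X Y)
qed

section \<open>Algebra endomorphisms and substitutions\<close>

context
  fixes \<phi> :: "'a::field ratfun2 \<Rightarrow> 'a ratfun2"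
  assumes \<phi>: "alg_endo \<phi>"
begin

lemma endo_add: "\<phi> (f + g) = \<phi> f + \<phi> g"
  and endo_mult: "\<phi> (f * g) = \<phi> f * \<phi> g"
  and endo_const: "\<phi> (ratconst c) = ratconst c"
  using \<phi> by (auto simp: alg_endo_def)

lemma endo_0: "\<phi> 0 = 0" and endo_1: "\<phi> 1 = 1"
  using endo_const[of 0] endo_const[of 1] by (simp_all add: rat_simps)

lemma endo_numeral: "\<phi> (numeral n) = numeral n"
  using endo_const[of "numeral n"] by (simp add: ratconst_numeral)

lemma endo_minus: "\<phi> (- f) = - \<phi> f"
  using endo_add[of f "- f"] by (simp add: endo_0 eq_neg_iff_add_eq_0 add.commute)

lemma endo_diff: "\<phi> (f - g) = \<phi> f - \<phi> g"
  using endo_add[of f "- g"] by (simp add: endo_minus)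

lemma endo_eq_0_iff: "\<phi> f = 0 \<longleftrightarrow> f = 0"
proof
  assume "\<phi> f = 0"
  show "f = 0"
  proof (rule ccontr)
    assume "f \<noteq> 0"
    then have "\<phi> f * \<phi> (inverse f) = 1" using endo_mult[of f "inverse f"] by (simp add: endo_1)
    with \<open>\<phi> f = 0\<close> show False by simp
  qed
qed (simp add: endo_0)

lemma endo_eq_iff: "\<phi> f = \<phi> g \<longleftrightarrow> f = g"
  using endo_eq_0_iff[of "f - g"] by (simp add: endo_diff)

lemma endo_divide: "\<phi> (f / g) = \<phi> f / \<phi> g"
proof (cases "g = 0")
  case False
  then have "\<phi> (f / g) * \<phi> g = \<phi> f" by (simp flip: endo_mult)
  then show ?thesis using False by (simp add: field_simps endo_eq_0_iff)
qed (simp add: endo_0)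

lemma endo_inverse: "\<phi> (inverse f) = inverse (\<phi> f)"
  using endo_divide[of 1 f] by (simp add: endo_1 inverse_eq_divide)

lemma endo_power: "\<phi> (f ^ n) = \<phi> f ^ n"
  by (induction n) (simp_all add: endo_1 endo_mult)

lemma endo_power_int: "\<phi> (f powi n) = \<phi> f powi n"
  by (simp add: power_int_def endo_power endo_inverse)

lemmas endo_simps = endo_add endo_mult endo_const endo_0 endo_1 endo_numeral endo_minus endo_diff
  endo_divide endo_inverse endo_power endo_power_int

end

lemma alg_endo_comp: "alg_endo \<phi> \<Longrightarrow> alg_endo \<psi> \<Longrightarrow> alg_endo (\<phi> \<circ> \<psi>)"
  by (simp add: alg_endo_def)

lemma alg_endo_id: "alg_endo (\<lambda>f. f)"
  by (simp add: alg_endo_def)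

text \<open>The relation between \<open>x\<close> and \<open>y\<close> that a pair must satisfy to be the image of \<open>(x, y)\<close> under a
Poisson endomorphism.\<close>

definition log_poisson_pair :: "'a::field ratfun2 \<Rightarrow> 'a ratfun2 \<Rightarrow> bool" where
  "log_poisson_pair u v \<longleftrightarrow> u \<noteq> 0 \<and> v \<noteq> 0 \<and> poisson_br v u = v * u"

text \<open>This is the chain rule: for a derivation \<open>d\<close> the map \<open>d \<circ> \<phi>\<close> is a derivation along \<open>\<phi>\<close>, hence a
combination of \<open>\<phi> \<circ> theta_x\<close> and \<open>\<phi> \<circ> theta_y\<close> with coefficients read off at \<open>x\<close> and \<open>y\<close>.
Applying this in both arguments of the bracket reduces the claim to the pair \<open>(\<phi> x, \<phi> y)\<close>.\<close>

lemma endo_poisson: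
  assumes \<phi>: "alg_endo \<phi>" and pair: "log_poisson_pair (\<phi> ratX) (\<phi> ratY)"
  shows "\<phi> (poisson_br f g) = poisson_br (\<phi> f) (\<phi> g)"
proof -
  note e = endo_simps[OF \<phi>]
  have chain: "d (\<phi> g) = \<phi> (theta_x g) * (d (\<phi> ratX) / \<phi> ratX) + \<phi> (theta_y g) * (d (\<phi> ratY) / \<phi> ratY)"
    if d: "is_derivation d" for d :: "'a ratfun2 \<Rightarrow> 'a ratfun2" and g
  proof -
    let ?R = "\<lambda>g. \<phi> (theta_x g) * (d (\<phi> ratX) / \<phi> ratX) + \<phi> (theta_y g) * (d (\<phi> ratY) / \<phi> ratY)"
    have nz: "\<phi> ratX \<noteq> 0" "\<phi> ratY \<noteq> 0" by (simp_all add: endo_eq_0_iff[OF \<phi>])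
    note tx = deriv_simps[OF derivation_theta_x] and ty = deriv_simps[OF derivation_theta_y]
      and dd = deriv_simps[OF d]
    have R: "?R (f + g) = ?R f + ?R g" "?R (f * g) = ?R f * \<phi> g + \<phi> f * ?R g" "?R (ratconst c) = 0"
      for f g c
      by (simp_all add: tx ty e algebra_simps)
    have poly: "d (\<phi> (to_fract p)) = ?R (to_fract p)" for p
    proof (induction p rule: poly_poly_induct)
      case (const c)
      then show ?case using R(3)[of c] by (simp add: dd e flip: ratconst_def)
    next
      case X
      then show ?case using nz by (simp add: theta_simps e flip: ratX_def)
    next
      case Y
      then show ?case using nz by (simp add: theta_simps e flip: ratY_def)
    next
      case (add p q)
      then show ?case by (simp only: to_fract_add R(1) e dd)
    next
      case (mult p q)
      then show ?case by (simp only: to_fract_mult R(2) e dd)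
    qed
    obtain a b where f: "g = to_fract a / to_fract b" "b \<noteq> 0" by (rule fract_to_fract_cases)
    then have eq: "g * to_fract b = to_fract a" by simp
    have "d (\<phi> g) * \<phi> (to_fract b) + \<phi> g * d (\<phi> (to_fract b))
      = ?R g * \<phi> (to_fract b) + \<phi> g * ?R (to_fract b)"
      unfolding R(2)[symmetric] unfolding eq using poly[of a] eq
      by (metis deriv_mult[OF d] endo_mult[OF \<phi>])
    then show ?thesis using f(2) by (simp add: poly endo_eq_0_iff[OF \<phi>])
  qed
  have nz: "\<phi> ratX \<noteq> 0" "\<phi> ratY \<noteq> 0" and br: "poisson_br (\<phi> ratY) (\<phi> ratX) = \<phi> ratY * \<phi> ratX"
    using pair by (simp_all add: log_poisson_pair_def)
  have br': "poisson_br (\<phi> ratX) (\<phi> ratY) = - (\<phi> ratY * \<phi> ratX)"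
    by (subst br_anti) (simp add: br)
  show ?thesis
    unfolding chain[OF derivation_br_right, of "\<phi> f" g]
      chain[OF derivation_br_left, of f "\<phi> ratX"] chain[OF derivation_br_left, of f "\<phi> ratY"] 
    using nz by (simp add: br br' br_self br_theta[of f g] e field_simps)
qed

lemma poly_eval_hom:
  fixes u v :: "'a::field ratfun2"
  obtains h :: "'a poly poly \<Rightarrow> 'a ratfun2" where
    "\<And>p q. h (p + q) = h p + h q" "\<And>p q. h (p * q) = h p * h q"
    "\<And>c. h [:[:c:]:] = ratconst c" "h [:[:0, 1:]:] = u" "h [:0, 1:] = v"
proof -
  define e where "e q = poly (map_poly ratconst q) u" for q
  define h where "h p = poly (map_poly e p) v" for p
  have e0: "e 0 = 0" by (simp add: e_def)
  have e_pCons: "e (pCons c q) = ratconst c + u * e q" for c q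
    by (simp add: e_def map_poly_pCons rat_simps)
  have e_add: "e (p + q) = e p + e q" for p q
    unfolding e_def by (subst map_poly_plus) (simp_all add: rat_simps)
  have h0: "h 0 = 0" by (simp add: h_def)
  have h_pCons: "h (pCons c p) = e c + v * h p" for c p
    by (simp add: h_def map_poly_pCons e0)
  have e_smult: "e (smult c p) = ratconst c * e p" for c p
    by (induction p) (simp_all add: e0 e_pCons rat_simps algebra_simps)
  have e_mult: "e (p * q) = e p * e q" for p q
    by (induction p) (simp_all add: e0 e_pCons e_add e_smult rat_simps algebra_simps)
  have h_add: "h (p + q) = h p + h q" for p q
    unfolding h_def by (subst map_poly_plus) (simp_all add: e0 e_add)
  have h_smult: "h (smult c p) = e c * h p" for c p
    by (induction p) (simp_all add: h0 h_pCons e_mult algebra_simps)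
  have h_mult: "h (p * q) = h p * h q" for p q
    by (induction p) (simp_all add: h0 h_pCons h_add h_smult e0 algebra_simps)
  show ?thesis
  proof (rule that[of h])
    show "h [:0, 1:] = v" using e_pCons[of 1 0] by (simp add: h_pCons h0 e0 rat_simps one_pCons)
  qed (simp_all add: h_add h_mult h_pCons e_pCons e0 h0 rat_simps)
qed

text \<open>A bracket relation \<open>{v, u} = v u \<noteq> 0\<close> already forces \<open>u\<close> and \<open>v\<close> to be algebraically independent, so
that \<open>x \<mapsto> u\<close>, \<open>y \<mapsto> v\<close> extends from polynomials to rational functions. Indeed, bracketing a
relation \<open>p(u, v) = 0\<close> with \<open>u\<close> or \<open>v\<close> multiplies by \<open>v u\<close> and differentiates \<open>p\<close>; in
characteristic zero repeated differentiation ends in a nonzero constant.\<close>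

lemma log_poisson_pair_substitution:
  fixes u v :: "'a::field_char_0 ratfun2"
  assumes pair: "log_poisson_pair u v"
  obtains \<phi> where "alg_endo \<phi>" "\<phi> ratX = u" "\<phi> ratY = v"
proof -
  obtain h :: "'a poly poly \<Rightarrow> 'a ratfun2" where h:
    "\<And>p q. h (p + q) = h p + h q" "\<And>p q. h (p * q) = h p * h q"
    "\<And>c. h [:[:c:]:] = ratconst c" "h [:[:0, 1:]:] = u" "h [:0, 1:] = v"
    using poly_eval_hom[of u v] by blast
  have h1: "h 1 = 1" using h(3)[of 1] by (simp add: rat_simps one_pCons)
  have h0: "h 0 = 0" using h(3)[of 0] by (simp add: rat_simps)
  have uv: "u \<noteq> 0" "v \<noteq> 0" "poisson_br v u = v * u" "poisson_br u v = - (v * u)"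
    using pair br_anti[of u v] by (simp_all add: log_poisson_pair_def)
  have const_nz: "ratconst c \<noteq> 0" if "c \<noteq> 0" for c :: 'a
    using that by (simp add: ratconst_def)
  let ?dx = "map_poly pderiv :: 'a poly poly \<Rightarrow> _"
  have dx_pCons: "?dx (pCons a p) = pCons (pderiv a) (?dx p)" for a p
    by (simp add: map_poly_pCons)
  have dx_add: "?dx (p + q) = ?dx p + ?dx q" for p q
    by (simp add: poly_eq_iff coeff_map_poly pderiv_add)
  have dx_smult: "?dx (smult c p) = smult (pderiv c) p + smult c (?dx p)" for c p
    by (simp add: poly_eq_iff coeff_map_poly pderiv_mult algebra_simps)
  have dx_mult: "?dx (p * q) = ?dx p * q + p * ?dx q" for p q
    by (induction p) (simp_all add: dx_pCons dx_add dx_smult algebra_simps)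
  have hX1: "h (pCons (pCons 0 1) 0) = u" and hY1: "h (pCons 0 1) = v"
    using h(4,5) by (simp_all add: one_pCons)
  have dx1: "?dx 1 = 0" by (simp add: one_pCons dx_pCons)
  have br_v: "poisson_br v (h p) = h (?dx p) * (v * u)" for p
    by (induction p rule: poly_poly_induct)
       (simp_all add: h h0 h1 hX1 hY1 dx1 dx_pCons dx_add dx_mult deriv_simps[OF derivation_br_right] br_self
          uv pderiv_pCons algebra_simps flip: one_pCons)
  have br_u: "poisson_br u (h p) = - h (pderiv p) * (v * u)" for p
    by (induction p rule: poly_poly_induct)
       (simp_all add: h h0 h1 hX1 hY1 pderiv_add pderiv_mult deriv_simps[OF derivation_br_right] br_self
          uv pderiv_pCons algebra_simps flip: one_pCons)
  have zero: "poisson_br f 0 = 0" for f :: "'a ratfun2"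
    by (rule deriv_0[OF derivation_br_right])
  have inner: "h [:q:] \<noteq> 0" if "q \<noteq> 0" for q
    using that
  proof (induction "degree q" arbitrary: q rule: less_induct)
    case less
    show ?case
    proof
      assume "h [:q:] = 0"
      then have "h [:pderiv q:] = 0" using br_v[of "[:q:]"] uv by (simp add: zero dx_pCons)
      with less.hyps[of "pderiv q"] have "degree q = 0"
        using less.prems by (cases "degree q = 0") (auto simp: degree_pderiv pderiv_eq_0_iff)
      then obtain c where "q = [:c:]" by (auto elim: degree_eq_zeroE)
      with \<open>h [:q:] = 0\<close> less.prems show False by (simp add: h const_nz)
    qed
  qed
  have nz: "h p \<noteq> 0" if "p \<noteq> 0" for p
    using that
  proof (induction "degree p" arbitrary: p rule: less_induct)
    case less
    show ?case
    proof
      assume "h p = 0"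
      then have "h (pderiv p) = 0" using br_u[of p] uv by (simp add: zero)
      with less.hyps[of "pderiv p"] have "degree p = 0"
        using less.prems by (cases "degree p = 0") (auto simp: degree_pderiv pderiv_eq_0_iff)
      then obtain q where "p = [:q:]" by (auto elim: degree_eq_zeroE)
      with \<open>h p = 0\<close> less.prems inner[of q] show False by simp
    qed
  qed
  obtain H where H: "\<And>f g. H (f + g) = H f + H g" "\<And>f g. H (f * g) = H f * H g"
      "\<And>p. H (to_fract p) = h p"
    using hom_extends[of h] h(1,2) h1 nz by metis
  show ?thesis
  proof (rule that[of H])
    have "H (ratconst c) = ratconst c" for c
      using H(3)[of "[:[:c:]:]"] h(3)[of c] by (simp add: ratconst_def)
    then show "alg_endo H" by (simp add: alg_endo_def H)
  qed (simp_all add: H h ratX_def ratY_def)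
qed

section \<open>Fixed fields of automorphisms of finite order\<close>

lemma of_nat_ratfun_nz: "n > 0 \<Longrightarrow> (of_nat n :: 'a::field_char_0 ratfun2) \<noteq> 0"
proof -
  have "(of_nat n :: 'a ratfun2) = ratconst (of_nat n)"
    by (induction n) (simp_all add: rat_simps)
  then show "n > 0 \<Longrightarrow> ?thesis" by (simp add: ratconst_def)
qed

definition subring_of :: "'a::field ratfun2 set \<Rightarrow> bool" where
  "subring_of R \<longleftrightarrow> range ratconst \<subseteq> R \<and> (\<forall>a\<in>R. \<forall>b\<in>R. a + b \<in> R \<and> a * b \<in> R)"

lemma subring_const: "subring_of R \<Longrightarrow> ratconst c \<in> R"
  and subring_add: "subring_of R \<Longrightarrow> a \<in> R \<Longrightarrow> b \<in> R \<Longrightarrow> a + b \<in> R"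
  and subring_mult: "subring_of R \<Longrightarrow> a \<in> R \<Longrightarrow> b \<in> R \<Longrightarrow> a * b \<in> R"
  by (auto simp: subring_of_def)

lemma subring_0: "subring_of R \<Longrightarrow> 0 \<in> R" and subring_1: "subring_of R \<Longrightarrow> 1 \<in> R"
  and subring_numeral: "subring_of R \<Longrightarrow> numeral n \<in> R"
  using subring_const[of R 0] subring_const[of R 1] subring_const[of R "numeral n"]
  by (simp_all add: rat_simps ratconst_numeral)

lemma subring_minus: "subring_of R \<Longrightarrow> a \<in> R \<Longrightarrow> - a \<in> R"
proof -
  have "ratconst (- 1) = - (1 :: 'a ratfun2)"
    using rat_simps(3)[of "- 1 :: 'a" 1] by (simp add: rat_simps eq_neg_iff_add_eq_0)
  then show "subring_of R \<Longrightarrow> a \<in> R \<Longrightarrow> - a \<in> R"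
    using subring_mult[OF _ subring_const[of R "- 1"], of a] by simp
qed

lemma subring_diff: "subring_of R \<Longrightarrow> a \<in> R \<Longrightarrow> b \<in> R \<Longrightarrow> a - b \<in> R"
  using subring_add[OF _ _ subring_minus, of R a b] by simp

lemma subring_power: "subring_of R \<Longrightarrow> a \<in> R \<Longrightarrow> a ^ n \<in> R"
  by (induction n) (auto simp: subring_1 subring_mult)

lemmas subring_intros = subring_const subring_0 subring_1 subring_numeral subring_add subring_mult
  subring_minus subring_diff subring_power

definition subfield_of :: "'a::field ratfun2 set \<Rightarrow> bool" where
  "subfield_of K \<longleftrightarrow> subring_of K \<and> (\<forall>a\<in>K. \<forall>b\<in>K. a / b \<in> K)"

lemma subfield_range:
  assumes \<phi>: "alg_endo \<phi>"
  shows "subfield_of (range \<phi>)"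
proof -
  have "\<phi> f + \<phi> g \<in> range \<phi>" "\<phi> f * \<phi> g \<in> range \<phi>" "\<phi> f / \<phi> g \<in> range \<phi>" "ratconst c \<in> range \<phi>" for f g c
    using endo_add[OF \<phi>] endo_mult[OF \<phi>] endo_divide[OF \<phi>] endo_const[OF \<phi>] by (metis rangeI)+
  then show ?thesis by (auto simp: subfield_of_def subring_of_def)
qed

lemma subfield_divide: "subfield_of K \<Longrightarrow> a \<in> K \<Longrightarrow> b \<in> K \<Longrightarrow> a / b \<in> K"
  and subfield_subring: "subfield_of K \<Longrightarrow> subring_of K"
  by (simp_all add: subfield_of_def)

definition quadratic_ext :: "'a::field ratfun2 set \<Rightarrow> 'a ratfun2 \<Rightarrow> 'a ratfun2 set" where
  "quadratic_ext R e = {a + b * e | a b. a \<in> R \<and> b \<in> R}"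

definition cubic_ext :: "'a::field ratfun2 set \<Rightarrow> 'a ratfun2 \<Rightarrow> 'a ratfun2 set" where
  "cubic_ext R e = {a + b * e + c * e ^ 2 | a b c. a \<in> R \<and> b \<in> R \<and> c \<in> R}"

lemma quadratic_extI: "a \<in> R \<Longrightarrow> b \<in> R \<Longrightarrow> a + b * e \<in> quadratic_ext R e"
  by (auto simp: quadratic_ext_def)

lemma quadratic_ext_subring:
  assumes R: "subring_of R" and pq: "p \<in> R" "q \<in> R" and e: "e ^ 2 = p * e + q"
  shows "subring_of (quadratic_ext R e)" "R \<subseteq> quadratic_ext R e" "e \<in> quadratic_ext R e"
proof -
  have sub: "a \<in> quadratic_ext R e" if "a \<in> R" for a
    using quadratic_extI[OF that subring_0[OF R], of e] by simp
  then show "R \<subseteq> quadratic_ext R e" by blast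
  show "e \<in> quadratic_ext R e"
    using quadratic_extI[OF subring_0[OF R] subring_1[OF R], of e] by simp
  have "(a + b * e) + (c + d * e) \<in> quadratic_ext R e \<and> (a + b * e) * (c + d * e) \<in> quadratic_ext R e"
    if "a \<in> R" "b \<in> R" "c \<in> R" "d \<in> R" for a b c d
  proof -
    have "(a + b * e) + (c + d * e) = (a + c) + (b + d) * e" by (simp add: algebra_simps)
    moreover have "(a + b * e) * (c + d * e) = (a * c + b * d * q) + (a * d + b * c + b * d * p) * e"
      using e by algebra
    ultimately show ?thesis
      using that pq
      by (auto simp only: intro!: quadratic_extI subring_add[OF R] subring_mult[OF R])
  qed
  moreover have "range ratconst \<subseteq> quadratic_ext R e" using sub subring_const[OF R] by blast
  ultimately show "subring_of (quadratic_ext R e)"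
    unfolding subring_of_def quadratic_ext_def by blast
qed

lemma cubic_extI: "a \<in> R \<Longrightarrow> b \<in> R \<Longrightarrow> c \<in> R \<Longrightarrow> a + b * e + c * e ^ 2 \<in> cubic_ext R e"
  by (auto simp: cubic_ext_def)

lemma cubic_ext_subring:
  assumes R: "subring_of R" and pqr: "p \<in> R" "q \<in> R" "r \<in> R" and e: "e ^ 3 = p * e ^ 2 + q * e + r"
  shows "subring_of (cubic_ext R e)" "R \<subseteq> cubic_ext R e" "e \<in> cubic_ext R e"
proof -
  have sub: "a \<in> cubic_ext R e" if "a \<in> R" for a
    using cubic_extI[OF that subring_0[OF R] subring_0[OF R], of e] by simp
  then show "R \<subseteq> cubic_ext R e" by blast
  show "e \<in> cubic_ext R e"
    using cubic_extI[OF subring_0[OF R] subring_1[OF R] subring_0[OF R], of e] by simp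
  have "(a + b * e + c * e ^ 2) + (a' + b' * e + c' * e ^ 2) \<in> cubic_ext R e \<and>
        (a + b * e + c * e ^ 2) * (a' + b' * e + c' * e ^ 2) \<in> cubic_ext R e"
    if "a \<in> R" "b \<in> R" "c \<in> R" "a' \<in> R" "b' \<in> R" "c' \<in> R" for a b c a' b' c'
  proof -
    have "(a + b * e + c * e ^ 2) + (a' + b' * e + c' * e ^ 2) = (a + a') + (b + b') * e + (c + c') * e ^ 2"
      by (simp add: algebra_simps)
    moreover have "(a + b * e + c * e ^ 2) * (a' + b' * e + c' * e ^ 2) =
        (a * a' + (b * c' + c * b') * r + c * c' * p * r)
      + (a * b' + b * a' + (b * c' + c * b') * q + c * c' * (p * q + r)) * e
      + (a * c' + b * b' + c * a' + (b * c' + c * b') * p + c * c' * (p ^ 2 + q)) * e ^ 2" (is "_ = ?rhs")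
    proof -
      have e4: "e ^ 4 = (p ^ 2 + q) * e ^ 2 + (p * q + r) * e + p * r"
      proof -
        have "e ^ 4 = e * e ^ 3" by (simp add: power4_eq_xxxx power3_eq_cube)
        also have "\<dots> = p * e ^ 3 + q * e ^ 2 + r * e"
          by (subst e) (simp add: algebra_simps power2_eq_square power3_eq_cube)
        also have "\<dots> = (p ^ 2 + q) * e ^ 2 + (p * q + r) * e + p * r"
          unfolding e by (simp add: algebra_simps power2_eq_square)
        finally show ?thesis .
      qed
      have "(a + b * e + c * e ^ 2) * (a' + b' * e + c' * e ^ 2)
          = a * a' + (a * b' + b * a') * e + (a * c' + b * b' + c * a') * e ^ 2
            + (b * c' + c * b') * e ^ 3 + c * c' * e ^ 4"
        by (simp add: algebra_simps power2_eq_square power3_eq_cube power4_eq_xxxx)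
      also have "\<dots> = ?rhs" unfolding e4 e by (simp add: algebra_simps)
      finally show ?thesis .
    qed
    ultimately show ?thesis
      using that pqr
      by (auto simp only: intro!: cubic_extI subring_add[OF R] subring_mult[OF R] subring_power[OF R])
  qed
  moreover have "range ratconst \<subseteq> cubic_ext R e" using sub subring_const[OF R] by blast
  ultimately show "subring_of (cubic_ext R e)"
    unfolding subring_of_def cubic_ext_def by blast
qed

text \<open>Write a fixed element as \<open>p / q\<close> with polynomials \<open>p\<close>, \<open>q\<close> and multiply numerator and denominator
by the conjugates of \<open>q\<close>. The denominator becomes the norm of \<open>q\<close> and is fixed; hence so is the
numerator, and both stay in the stable ring \<open>M\<close>. A fixed element of \<open>M\<close> equals its trace up to the
invertible factor \<open>m + 1\<close>, so the quotient of the two lies in \<open>K\<close>. The criterion thus asks for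
traces of ring elements only and avoids all degree computations.\<close>

lemma fixed_in_subfield:
  fixes \<sigma> :: "'a::field_char_0 ratfun2 \<Rightarrow> 'a ratfun2"
  assumes \<sigma>: "alg_endo \<sigma>" and order: "\<And>f. (\<sigma> ^^ Suc m) f = f"
    and M: "subring_of M" "ratX \<in> M" "ratY \<in> M" "\<And>f. f \<in> M \<Longrightarrow> \<sigma> f \<in> M"
    and K: "subfield_of K" and trace: "\<And>f. f \<in> M \<Longrightarrow> (\<Sum>i\<le>m. (\<sigma> ^^ i) f) \<in> K"
    and fixed: "\<sigma> f = f"
  shows "f \<in> K"
proof -
  have poly: "to_fract p \<in> M" for p
    by (induction p rule: poly_poly_induct)
       (simp_all add: M(2,3) subring_const[OF M(1)] subring_add[OF M(1)] subring_mult[OF M(1)]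
          flip: ratconst_def ratX_def ratY_def)
  obtain p q where pq: "f = to_fract p / to_fract q" "q \<noteq> 0" by (rule fract_to_fract_cases)
  define R where "R = (\<Prod>i<m. (\<sigma> ^^ Suc i) (to_fract q))"
  define N where "N = to_fract q * R"
  have iter: "(\<sigma> ^^ i) g \<in> M" if "g \<in> M" for i g
    by (induction i) (use that M(4) in auto)
  have iter_nz: "(\<sigma> ^^ i) (to_fract q) \<noteq> 0" for i
    by (induction i) (use pq endo_eq_0_iff[OF \<sigma>] in auto)
  have prod_M: "(\<Prod>i\<in>A. (\<sigma> ^^ Suc i) (to_fract q)) \<in> M" if "finite A" for A
    using that by (induction A) (simp_all add: subring_1[OF M(1)] subring_mult[OF M(1)] iter[OF poly] M(4))
  have "N \<noteq> 0" unfolding N_def R_def using pq iter_nz by (auto simp del: funpow.simps)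
  have sigma_prod: "\<sigma> (\<Prod>i\<in>A. g i) = (\<Prod>i\<in>A. \<sigma> (g i))" if "finite A" for A :: "nat set" and g
    using that by (induction A) (simp_all add: endo_simps[OF \<sigma>])
  have N_alt: "N = (\<Prod>i<Suc m. (\<sigma> ^^ i) (to_fract q))"
    unfolding N_def R_def prod.lessThan_Suc_shift by simp
  have "\<sigma> N = (\<Prod>i<Suc m. (\<sigma> ^^ Suc i) (to_fract q))"
    unfolding N_alt by (simp add: sigma_prod endo_mult[OF \<sigma>])
  also have "\<dots> = R * (\<sigma> ^^ Suc m) (to_fract q)" unfolding R_def by (rule prod.lessThan_Suc)
  also have "\<dots> = N" unfolding order N_def by simp
  finally have \<sigma>N: "\<sigma> N = N" .
  have "to_fract p * R = f * N" using pq by (simp add: N_def)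
  then have \<sigma>P: "\<sigma> (to_fract p * R) = to_fract p * R" using \<sigma>N fixed by (simp add: endo_mult[OF \<sigma>])
  have R: "R \<in> M" unfolding R_def by (rule prod_M) simp
  have NM: "N \<in> M" unfolding N_def by (rule subring_mult[OF M(1) poly R])
  have tr: "of_nat (Suc m) * g \<in> K" if "g \<in> M" "\<sigma> g = g" for g
  proof -
    have "(\<sigma> ^^ i) g = g" for i by (induction i) (simp_all add: that)
    then show ?thesis using trace[OF that(1)] by simp
  qed
  have "of_nat (Suc m) * (to_fract p * R) / (of_nat (Suc m) * N) \<in> K"
    by (intro subfield_divide[OF K] tr)
       (simp_all add: \<sigma>N \<sigma>P N_def[symmetric] subring_mult[OF M(1)] R poly NM)
  moreover have "of_nat (Suc m) * (to_fract p * R) / (of_nat (Suc m) * N) = f"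
    using of_nat_ratfun_nz[where 'a = 'a, of "Suc m"] \<open>N \<noteq> 0\<close> \<open>to_fract p * R = f * N\<close> by simp
  ultimately show ?thesis by simp
qed

text \<open>Here \<open>M\<close> is spanned over \<open>K\<close> by \<open>1\<close>, \<open>x\<close>, \<open>y\<close>, \<open>x y\<close>: it is a ring because \<open>x\<close> and \<open>y\<close> are
quadratic over \<open>K\<close>, and the traces of the four basis elements are \<open>2\<close> and the three given
generators. The constant \<open>c\<close> covers both the inversion and its twist by a sign.\<close>

lemma involution_fixed:
  fixes \<sigma> :: "'a::field_char_0 ratfun2 \<Rightarrow> 'a ratfun2"
  assumes \<sigma>: "alg_endo \<sigma>" "\<sigma> ratX = 1 / ratX" "\<sigma> ratY = ratconst c / ratY" and c: "c \<noteq> 0"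
    and K: "subfield_of K" "\<And>f. f \<in> K \<Longrightarrow> \<sigma> f = f"
    and gens: "ratX + 1 / ratX \<in> K" "ratY + ratconst c / ratY \<in> K"
      "ratX * ratY + ratconst c / (ratX * ratY) \<in> K"
    and fixed: "\<sigma> f = f"
  shows "f \<in> K"
proof -
  let ?x = "ratX :: 'a ratfun2" and ?y = "ratY :: 'a ratfun2" and ?c = "ratconst c"
  have c_nz: "?c \<noteq> 0" using c by (simp add: ratconst_def)
  define M0 where "M0 = quadratic_ext K ?x"
  define M where "M = quadratic_ext M0 ?y"
  note KR = subfield_subring[OF K(1)]
  note e = endo_simps[OF \<sigma>(1)]
  have x2: "?x ^ 2 = (?x + 1 / ?x) * ?x + (- 1)" by (simp add: field_simps power2_eq_square)
  have M0: "subring_of M0" "K \<subseteq> M0" "?x \<in> M0"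
    unfolding M0_def by (rule quadratic_ext_subring[OF KR gens(1) _ x2]; use KR in \<open>auto intro: subring_intros\<close>)+
  have y2: "?y ^ 2 = (?y + ?c / ?y) * ?y + (- ?c)" by (simp add: field_simps power2_eq_square)
  have "?y + ?c / ?y \<in> M0" "- ?c \<in> M0" using gens(2) M0 by (auto intro: subring_intros)
  from quadratic_ext_subring[OF M0(1) this y2]
  have M: "subring_of M" "M0 \<subseteq> M" "?y \<in> M" unfolding M_def by auto
  have KM: "K \<subseteq> M" using M0 M by blast
  have inv_M: "1 / ?x \<in> M" "?c / ?y \<in> M"
  proof -
    have "(?x + 1 / ?x) - ?x \<in> M" "(?y + ?c / ?y) - ?y \<in> M"
      using subsetD[OF KM gens(1)] subsetD[OF KM gens(2)] subsetD[OF M(2) M0(3)] M(3)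
      by (auto intro!: subring_diff[OF M(1)] simp only:)
    then show "1 / ?x \<in> M" "?c / ?y \<in> M" by (simp_all only: add_diff_cancel_left')
  qed
  have form: "\<exists>a\<in>K. \<exists>b\<in>K. \<exists>p\<in>K. \<exists>q\<in>K. g = a + b * ?x + (p + q * ?x) * ?y" if "g \<in> M" for g
    using that unfolding M_def M0_def quadratic_ext_def by blast
  show ?thesis
  proof (rule fixed_in_subfield[OF \<sigma>(1) _ M(1) _ _ _ K(1) _ fixed, of 1])
    have "\<sigma> \<circ> \<sigma> = (\<lambda>f. f)"
      by (rule alg_endo_ext)
         (use \<sigma> c_nz in \<open>simp_all add: alg_endo_comp alg_endo_id e\<close>)
    then show "(\<sigma> ^^ Suc 1) f = f" for f by (simp add: fun_eq_iff)
    show "?x \<in> M" "?y \<in> M" using M0 M by auto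
  next
    fix g assume "g \<in> M"
    then obtain a b p q where K4: "a \<in> K" "b \<in> K" "p \<in> K" "q \<in> K" and g: "g = a + b * ?x + (p + q * ?x) * ?y"
      using form by blast
    have \<sigma>g: "\<sigma> g = a + b * (1 / ?x) + (p + q * (1 / ?x)) * (?c / ?y)"
      unfolding g by (simp only: e \<sigma>(2,3) K(2)[OF K4(1)] K(2)[OF K4(2)] K(2)[OF K4(3)] K(2)[OF K4(4)])
    have "a \<in> M" "b \<in> M" "p \<in> M" "q \<in> M" using K4 KM by auto
    then show "\<sigma> g \<in> M" unfolding \<sigma>g using inv_M by (intro subring_add[OF M(1)] subring_mult[OF M(1)])
    have comb: "2 * a + b * X + p * Y + q * Z \<in> K" if "X \<in> K" "Y \<in> K" "Z \<in> K" for X Y Z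
      using K4 that by (auto simp only: intro!: subring_intros[OF KR])
    have "g + \<sigma> g = 2 * a + b * (?x + 1 / ?x) + p * (?y + ?c / ?y) + q * (?x * ?y + ?c / (?x * ?y))"
      unfolding \<sigma>g unfolding g by (simp add: algebra_simps)
    moreover have "\<dots> \<in> K"
      by (rule comb[OF gens])
    ultimately have "g + \<sigma> g \<in> K" by simp
    moreover have "(\<Sum>i\<le>(1::nat). (\<sigma> ^^ i) g) = g + \<sigma> g" by simp
    ultimately show "(\<Sum>i\<le>1. (\<sigma> ^^ i) g) \<in> K" by metis
  qed
qed

text \<open>The automorphism permutes \<open>x\<close>, \<open>y\<close>, \<open>z = 1/(x y)\<close> cyclically. Over \<open>K\<close> the element \<open>x\<close> is a root of
a cubic, and \<open>y\<close> is a root of the quadratic with roots \<open>y\<close> and \<open>z\<close>, so the \<open>x^i y^j\<close> with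
\<open>i \<le> 2\<close>, \<open>j \<le> 1\<close> span a stable ring. Their traces are polynomials in the elementary symmetric
functions and in the cyclic sum of \<open>x^2 y\<close>.\<close>

lemma order3_fixed:
  fixes \<sigma> :: "'a::field_char_0 ratfun2 \<Rightarrow> 'a ratfun2"
  defines "z \<equiv> 1 / (ratX * ratY)"
  assumes \<sigma>: "alg_endo \<sigma>" "\<sigma> ratX = z" "\<sigma> ratY = ratX"
    and K: "subfield_of K" "\<And>f. f \<in> K \<Longrightarrow> \<sigma> f = f"
    and gens: "ratX + ratY + z \<in> K" "ratX * ratY + ratY * z + z * ratX \<in> K"
      "ratX ^ 2 * ratY + ratY ^ 2 * z + z ^ 2 * ratX \<in> K"
    and fixed: "\<sigma> f = f"
  shows "f \<in> K"
proof -
  let ?x = "ratX :: 'a ratfun2" and ?y = "ratY :: 'a ratfun2"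
  define s where "s = ?x + ?y + z"
  define t where "t = ?x * ?y + ?y * z + z * ?x"
  define d where "d = ?x ^ 2 * ?y + ?y ^ 2 * z + z ^ 2 * ?x"
  have gens': "s \<in> K" "t \<in> K" "d \<in> K" using gens by (simp_all add: s_def t_def d_def)
  have xyz: "?x * ?y * z = 1" by (simp add: z_def)
  define M0 where "M0 = cubic_ext K ?x"
  define M where "M = quadratic_ext M0 ?y"
  note KR = subfield_subring[OF K(1)]
  note e = endo_simps[OF \<sigma>(1)]
  have \<sigma>z: "\<sigma> z = ?y" unfolding z_def by (simp add: e \<sigma>) (simp add: z_def)
  have x3: "?x ^ 3 = s * ?x ^ 2 + (- t) * ?x + 1"
    unfolding s_def t_def using xyz by algebra
  have M0: "subring_of M0" "K \<subseteq> M0" "?x \<in> M0"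
    unfolding M0_def
    by (rule cubic_ext_subring[OF KR gens'(1) _ _ x3]; use KR gens' in \<open>auto intro: subring_intros\<close>)+
  have y2: "?y ^ 2 = (s - ?x) * ?y + (- (?x ^ 2 - s * ?x + t))"
    unfolding s_def t_def by (simp add: algebra_simps power2_eq_square)
  have sM0: "s \<in> M0" "t \<in> M0" using gens' M0 by auto
  have "s - ?x \<in> M0" "- (?x ^ 2 - s * ?x + t) \<in> M0"
    using sM0 M0(3) by (auto simp only: intro!: subring_intros[OF M0(1)])
  from quadratic_ext_subring[OF M0(1) this y2]
  have M: "subring_of M" "M0 \<subseteq> M" "?y \<in> M" unfolding M_def by auto
  have KM: "K \<subseteq> M" using M0 M by blast
  have x: "?x \<in> M" using M0 M by blast
  have "s - ?x - ?y \<in> M" using M x sM0 by (blast intro: subring_diff)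
  then have z: "z \<in> M" by (simp add: s_def)
  have form: "\<exists>a0\<in>K. \<exists>a1\<in>K. \<exists>a2\<in>K. \<exists>b0\<in>K. \<exists>b1\<in>K. \<exists>b2\<in>K.
      g = a0 + a1 * ?x + a2 * ?x ^ 2 + (b0 + b1 * ?x + b2 * ?x ^ 2) * ?y" if "g \<in> M" for g
    using that unfolding M_def M0_def quadratic_ext_def cubic_ext_def by blast
  show ?thesis
  proof (rule fixed_in_subfield[OF \<sigma>(1) _ M(1) _ _ _ K(1) _ fixed, of 2])
    have "\<sigma> \<circ> (\<sigma> \<circ> \<sigma>) = (\<lambda>f. f)"
      by (rule alg_endo_ext)
         (use \<sigma> \<sigma>z in \<open>simp_all add: alg_endo_comp alg_endo_id\<close>)
    then show "(\<sigma> ^^ Suc 2) f = f" for f by (simp add: fun_eq_iff numeral_2_eq_2)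
    show "?x \<in> M" "?y \<in> M" using x M by auto
  next
    fix g assume "g \<in> M"
    then obtain a0 a1 a2 b0 b1 b2 where K6: "a0 \<in> K" "a1 \<in> K" "a2 \<in> K" "b0 \<in> K" "b1 \<in> K" "b2 \<in> K"
      and g: "g = a0 + a1 * ?x + a2 * ?x ^ 2 + (b0 + b1 * ?x + b2 * ?x ^ 2) * ?y"
      using form by blast
    note k = K(2)[OF K6(1)] K(2)[OF K6(2)] K(2)[OF K6(3)] K(2)[OF K6(4)] K(2)[OF K6(5)] K(2)[OF K6(6)]
    have \<sigma>g: "\<sigma> g = a0 + a1 * z + a2 * z ^ 2 + (b0 + b1 * z + b2 * z ^ 2) * ?x"
      unfolding g by (simp only: e \<sigma>(2,3) k)
    have \<sigma>\<sigma>g: "\<sigma> (\<sigma> g) = a0 + a1 * ?y + a2 * ?y ^ 2 + (b0 + b1 * ?y + b2 * ?y ^ 2) * z"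
      unfolding \<sigma>g by (simp only: e \<sigma>(2,3) \<sigma>z k)
    have "a0 \<in> M" "a1 \<in> M" "a2 \<in> M" "b0 \<in> M" "b1 \<in> M" "b2 \<in> M" using K6 KM by auto
    then show "\<sigma> g \<in> M"
      unfolding \<sigma>g using x z by (intro subring_add[OF M(1)] subring_mult[OF M(1)] subring_power[OF M(1)])
    have "g + \<sigma> g + \<sigma> (\<sigma> g)
        = 3 * a0 + a1 * s + a2 * (s ^ 2 - 2 * t) + b0 * s + b1 * t + b2 * d"
      unfolding \<sigma>\<sigma>g unfolding \<sigma>g unfolding g s_def t_def d_def
      by (simp add: algebra_simps power2_eq_square)
    moreover have "\<dots> \<in> K"
      using K6 gens' by (auto simp only: intro!: subring_intros[OF KR])
    ultimately have "g + \<sigma> g + \<sigma> (\<sigma> g) \<in> K" by simp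
    moreover have "(\<Sum>i\<le>(2::nat). (\<sigma> ^^ i) g) = g + \<sigma> g + \<sigma> (\<sigma> g)"
      by (simp add: numeral_2_eq_2)
    ultimately show "(\<Sum>i\<le>2. (\<sigma> ^^ i) g) \<in> K" by metis
  qed
qed

section \<open>Generators for inversions\<close>

lemmas theta_x_simps = deriv_simps[OF derivation_theta_x] theta_simps
  and theta_y_simps = deriv_simps[OF derivation_theta_y] theta_simps

lemma two_nz: "(2 :: 'a::field_char_0 ratfun2) \<noteq> 0"
  using of_nat_ratfun_nz[where 'a = 'a, of 2] by simp

text \<open>Each inequality is certified by a derivation: an Euler operator kills the constant but not the
monomial.\<close>

lemma generator_nz:
  fixes c :: "'a::field_char_0"
  shows "(ratX :: 'a ratfun2) \<noteq> ratconst c" "(ratY :: 'a ratfun2) \<noteq> ratconst c"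
    "ratX * ratY \<noteq> ratconst c"
    "ratX * ratY ^ 2 \<noteq> ratconst c" "ratY ^ 2 \<noteq> ratconst c"
proof -
  let ?x = "ratX :: 'a ratfun2" and ?y = "ratY :: 'a ratfun2"
  have "theta_x ?x \<noteq> theta_x (ratconst c)" "theta_y ?y \<noteq> theta_y (ratconst c)"
    "theta_x (?x * ?y) \<noteq> theta_x (ratconst c)"
    "theta_x (?x * ?y ^ 2) \<noteq> theta_x (ratconst c)" "theta_y (?y ^ 2) \<noteq> theta_y (ratconst c)"
    by (simp_all add: theta_x_simps theta_y_simps two_nz)
  then show "?x \<noteq> ratconst c" "?y \<noteq> ratconst c" "?x * ?y \<noteq> ratconst c"
    "?x * ?y ^ 2 \<noteq> ratconst c" "?y ^ 2 \<noteq> ratconst c"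
    by metis+
qed

lemma ratX_neq_ratY: "(ratX :: 'a::field_char_0 ratfun2) \<noteq> ratY"
proof
  assume "(ratX :: 'a ratfun2) = ratY"
  then have "theta_x (ratX :: 'a ratfun2) = theta_x ratY" by simp
  then show False by (simp add: theta_simps)
qed

lemmas generator_nz1 = generator_nz[of 1, unfolded rat_simps(2)]

lemma ratconst_m1: "ratconst (- 1) = - 1"
  using rat_simps(3)[of "- 1" 1] by (simp add: rat_simps eq_neg_iff_add_eq_0)

lemmas generator_nzm1 = generator_nz[of "- 1", unfolded ratconst_m1]

text \<open>The invariants \<open>X = x + 1/x\<close>, \<open>Y = y + 1/y\<close>, \<open>Z = x y + 1/(x y)\<close> of the inversion satisfy
\<open>X^2 + Y^2 + Z^2 - X Y Z = 4\<close>, a cubic surface with a node at \<open>(2, 2, 2)\<close>. Projection from the node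
makes it rational, with coordinates \<open>s = (Y - 2)/(X - 2)\<close> and \<open>t = (Z - 2)/(X - 2)\<close>, and it takes
\<open>dx \<and> dy / (x y)\<close> to the logarithmic form in \<open>s\<close> and \<open>t\<close> up to sign. The second generator is
\<open>r = (1 - s)/t\<close> instead of \<open>t\<close>, because the automorphism \<open>x \<mapsto> 1/y\<close>, \<open>y \<mapsto> x\<close> acts on \<open>(s, r)\<close> by
\<open>s \<mapsto> 1/s\<close>, \<open>r \<mapsto> - 1/r\<close>. The explicit values are part of the statement for that reason.\<close>

lemma order2_generators:
  obtains \<phi> :: "'a::field_char_0 ratfun2 \<Rightarrow> 'a ratfun2" where
    "alg_endo \<phi>" "log_poisson_pair (\<phi> ratX) (\<phi> ratY)"
    "\<phi> ratX = ratX * (ratY - 1) ^ 2 / (ratY * (ratX - 1) ^ 2)"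
    "\<phi> ratY = (ratX - ratY) / (ratX * ratY - 1)"
    "\<And>\<sigma> f. alg_endo \<sigma> \<Longrightarrow> \<sigma> ratX = 1 / ratX \<Longrightarrow> \<sigma> ratY = 1 / ratY \<Longrightarrow> \<sigma> f = f \<longleftrightarrow> f \<in> range \<phi>"
proof -
  define x y :: "'a ratfun2" where "x = ratX" and "y = ratY"
  note xy = x_def[symmetric] y_def[symmetric]
  define s where "s = x * (y - 1) ^ 2 / (y * (x - 1) ^ 2)"
  define r where "r = (x - y) / (x * y - 1)"
  have nz0: "x \<noteq> 0" "y \<noteq> 0" by (simp_all add: x_def y_def)
  have nz: "x \<noteq> 0" "y \<noteq> 0" "x - 1 \<noteq> 0" "y - 1 \<noteq> 0" "x - y \<noteq> 0" "x * y - 1 \<noteq> 0"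
    using generator_nz1[where 'a = 'a] ratX_neq_ratY[where 'a = 'a] by (simp_all add: xy nz0)
  have \<theta>: "theta_x x = x" "theta_x y = 0" "theta_y x = 0" "theta_y y = y"
    by (simp_all add: x_def y_def theta_simps)
  note tx = theta_x_simps \<theta> and ty = theta_y_simps \<theta>
  have tx_s: "theta_x s = - s * (x + 1) / (x - 1)" and ty_s: "theta_y s = s * (y + 1) / (y - 1)"
    unfolding s_def using nz
    by (simp_all add: deriv_divide[OF derivation_theta_x] deriv_divide[OF derivation_theta_y] tx ty
        divide_simps) (algebra+)
  have tx_r: "theta_x r = x * (y ^ 2 - 1) / (x * y - 1) ^ 2"
    and ty_r: "theta_y r = y * (1 - x ^ 2) / (x * y - 1) ^ 2"
    unfolding r_def using nz
    by (simp_all add: deriv_divide[OF derivation_theta_x] deriv_divide[OF derivation_theta_y] tx ty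
        divide_simps) (algebra+)
  have "poisson_br r s = s * ((x - y) * (x * y - 1) / (x * y - 1) ^ 2)"
    unfolding br_theta tx_s ty_s tx_r ty_r using nz
    by (simp add: divide_simps) algebra
  also have "\<dots> = r * s" using nz by (simp add: r_def power2_eq_square)
  finally have pair: "log_poisson_pair s r" using nz by (simp add: log_poisson_pair_def s_def r_def)
  obtain \<phi> where \<phi>: "alg_endo \<phi>" "\<phi> ratX = s" "\<phi> ratY = r" using log_poisson_pair_substitution[OF pair] .
  have K: "subfield_of (range \<phi>)" by (rule subfield_range[OF \<phi>(1)])
  note KR = subfield_subring[OF K]
  have sr: "s \<in> range \<phi>" "r \<in> range \<phi>" using \<phi>(2,3) by (metis rangeI)+
  show ?thesis
  proof (rule that[OF \<phi>(1)])
    show "log_poisson_pair (\<phi> ratX) (\<phi> ratY)" using pair \<phi> by simp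
    show "\<phi> ratX = ratX * (ratY - 1) ^ 2 / (ratY * (ratX - 1) ^ 2)"
      "\<phi> ratY = (ratX - ratY) / (ratX * ratY - 1)"
      using \<phi> by (simp_all add: s_def r_def x_def y_def)
    fix \<sigma> :: "'a ratfun2 \<Rightarrow> 'a ratfun2" and f
    assume \<sigma>: "alg_endo \<sigma>" "\<sigma> ratX = 1 / ratX" "\<sigma> ratY = 1 / ratY"
    note e = endo_simps[OF \<sigma>(1)] and \<sigma>xy = \<sigma>(2,3)[unfolded xy]
    have nz': "1 / x - 1 \<noteq> 0" "1 / x * (1 / y) - 1 \<noteq> 0" "1 - x \<noteq> 0" "1 - x * y \<noteq> 0"
      using nz by (auto simp: field_simps)
    have "\<sigma> s = s" "\<sigma> r = r"
      unfolding s_def r_def e \<sigma>xy using nz nz'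
      by (simp_all add: divide_simps) (algebra+)
    then have "\<sigma> \<circ> \<phi> = \<phi>"
      by (intro alg_endo_ext) (simp_all add: alg_endo_comp \<sigma> \<phi>)
    then have inv: "\<sigma> g = g" if "g \<in> range \<phi>" for g using that by (auto simp: fun_eq_iff)
    \<comment> \<open>This is \<open>X - 2\<close>, the solution of the equation of the surface along the line through the
      node with direction \<open>(1, s, t)\<close>.\<close>
    define a where "a = ((r - 1) ^ 2 - s * (r + 1) ^ 2) / (s * r)"
    have X: "x + 1 / x = a + 2" and Y: "y + 1 / y = s * a + 2"
      and Z: "x * y + 1 / (x * y) = (1 - s) / r * a + 2"
    proof -
      have r1: "r - 1 = (x + 1) * (1 - y) / (x * y - 1)" and r2: "r + 1 = (x - 1) * (y + 1) / (x * y - 1)"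
        unfolding r_def using nz by (simp_all add: divide_simps) (algebra+)
      have "a * (s * r) = ((r - 1) ^ 2 - s * (r + 1) ^ 2)"
        using pair by (simp add: a_def log_poisson_pair_def)
      also have "\<dots> = (x - 1) ^ 2 / x * (s * r)"
        unfolding r1 r2 unfolding s_def r_def using nz
        by (simp add: divide_simps power_divide power_mult_distrib) algebra
      finally have "a * (s * r) = (x - 1) ^ 2 / x * (s * r)" .
      moreover have "s * r \<noteq> 0" using pair by (simp add: log_poisson_pair_def)
      ultimately have a: "a = (x - 1) ^ 2 / x" using mult_right_cancel by blast
      show "x + 1 / x = a + 2" unfolding a using nz by (simp add: divide_simps) algebra
      show "y + 1 / y = s * a + 2" unfolding a s_def using nz by (simp add: divide_simps) algebra
      have "1 - s = (x * y - 1) * (x - y) / (y * (x - 1) ^ 2)"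
        unfolding s_def using nz by (simp add: divide_simps) algebra
      then show "x * y + 1 / (x * y) = (1 - s) / r * a + 2"
        unfolding a r_def using nz by (simp add: divide_simps) algebra
    qed
    have a: "a \<in> range \<phi>"
      unfolding a_def using sr by (auto simp only: intro!: subfield_divide[OF K] subring_intros[OF KR])
    show "\<sigma> f = f \<longleftrightarrow> f \<in> range \<phi>"
    proof
      assume f: "\<sigma> f = f"
      show "f \<in> range \<phi>"
      proof (rule involution_fixed[OF \<sigma>(1,2) _ _ K inv _ _ _ f, of 1], unfold xy rat_simps X Y Z)
        show "a + 2 \<in> range \<phi>" "s * a + 2 \<in> range \<phi>" "(1 - s) / r * a + 2 \<in> range \<phi>"
          using sr a by (auto simp only: intro!: subfield_divide[OF K] subring_intros[OF KR])
      qed (use \<sigma> in \<open>simp_all add: xy\<close>)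
    qed (rule inv)
  qed
qed

text \<open>Now the invariants \<open>X = x + 1/x\<close>, \<open>Y = y - 1/y\<close>, \<open>Z = x y - 1/(x y)\<close> satisfy
\<open>(X - 2) (X + 2 + Y Z) = (Y - Z)^2\<close>. The two nodes with \<open>X = 2\<close> need not be rational over the ground
field, but the line \<open>X = 2\<close>, \<open>Y = Z\<close> through them is. With \<open>w = (Y - Z)/(X - 2)\<close> the equation
becomes linear in \<open>X\<close>, and the field is generated by \<open>w\<close> and \<open>Y\<close>. The invariant form is
\<open>dY \<and> dw\<close> divided by \<open>w^2 + w Y - 1\<close> up to sign, so \<open>v = w^2 + w Y - 1\<close> in place of \<open>Y\<close> makes
it logarithmic.\<close>

lemma twisted_involution_generators:
  obtains \<phi> :: "'a::field_char_0 ratfun2 \<Rightarrow> 'a ratfun2" where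
    "alg_endo \<phi>" "log_poisson_pair (\<phi> ratX) (\<phi> ratY)"
    "\<And>\<sigma> f. alg_endo \<sigma> \<Longrightarrow> \<sigma> ratX = 1 / ratX \<Longrightarrow> \<sigma> ratY = - 1 / ratY \<Longrightarrow> \<sigma> f = f \<longleftrightarrow> f \<in> range \<phi>"
proof -
  define x y :: "'a ratfun2" where "x = ratX" and "y = ratY"
  note xy = x_def[symmetric] y_def[symmetric]
  define w where "w = (x * y ^ 2 + 1) / (y * (1 - x))"
  define v where "v = x * (y ^ 2 + 1) ^ 2 / (y ^ 2 * (1 - x) ^ 2)"
  have nz0: "x \<noteq> 0" "y \<noteq> 0" by (simp_all add: x_def y_def)
  have nz: "x \<noteq> 0" "y \<noteq> 0" "1 - x \<noteq> 0" "x * y ^ 2 + 1 \<noteq> 0" "y ^ 2 + 1 \<noteq> 0"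
    using generator_nz1[where 'a = 'a] generator_nzm1[where 'a = 'a]
    by (simp_all add: xy nz0 eq_neg_iff_add_eq_0)
  have \<theta>: "theta_x x = x" "theta_x y = 0" "theta_y x = 0" "theta_y y = y"
    by (simp_all add: x_def y_def theta_simps)
  note tx = theta_x_simps \<theta> and ty = theta_y_simps \<theta>
  have tx_v: "theta_x v = v * (1 + x) / (1 - x)" and ty_v: "theta_y v = v * 2 * (y ^ 2 - 1) / (y ^ 2 + 1)"
    unfolding v_def using nz
    by (simp_all add: deriv_divide[OF derivation_theta_x] deriv_divide[OF derivation_theta_y] tx ty
        divide_simps) (algebra+)
  have tx_w: "theta_x w = x * (y ^ 2 + 1) / (y * (1 - x) ^ 2)"
    and ty_w: "theta_y w = (x * y ^ 2 - 1) / (y * (1 - x))"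
    unfolding w_def using nz
    by (simp_all add: deriv_divide[OF derivation_theta_x] deriv_divide[OF derivation_theta_y] tx ty
        divide_simps) (algebra+)
  have "poisson_br v w = v * ((1 - x) * (x * y ^ 2 + 1) / (y * (1 - x) ^ 2))"
    unfolding br_theta tx_v ty_v tx_w ty_w using nz
    by (simp add: divide_simps) algebra
  also have "\<dots> = v * w" using nz by (simp add: w_def power2_eq_square)
  finally have pair: "log_poisson_pair w v" using nz by (simp add: log_poisson_pair_def w_def v_def)
  obtain \<phi> where \<phi>: "alg_endo \<phi>" "\<phi> ratX = w" "\<phi> ratY = v" using log_poisson_pair_substitution[OF pair] .
  have K: "subfield_of (range \<phi>)" by (rule subfield_range[OF \<phi>(1)])
  note KR = subfield_subring[OF K]
  have wv: "w \<in> range \<phi>" "v \<in> range \<phi>" using \<phi>(2,3) by (metis rangeI)+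
  show ?thesis
  proof (rule that[OF \<phi>(1)])
    show "log_poisson_pair (\<phi> ratX) (\<phi> ratY)" using pair \<phi> by simp
    fix \<sigma> :: "'a ratfun2 \<Rightarrow> 'a ratfun2" and f
    assume \<sigma>: "alg_endo \<sigma>" "\<sigma> ratX = 1 / ratX" "\<sigma> ratY = - 1 / ratY"
    note e = endo_simps[OF \<sigma>(1)] and \<sigma>xy = \<sigma>(2,3)[unfolded xy]
    have nz': "1 - 1 / x \<noteq> 0" "x - 1 \<noteq> 0"
      using nz by (auto simp: field_simps)
    have "\<sigma> w = w" "\<sigma> v = v"
      unfolding w_def v_def e \<sigma>xy using nz nz'
      by (simp_all add: divide_simps) (algebra+)
    then have "\<sigma> \<circ> \<phi> = \<phi>"
      by (intro alg_endo_ext) (simp_all add: alg_endo_comp \<sigma> \<phi>)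
    then have inv: "\<sigma> g = g" if "g \<in> range \<phi>" for g using that by (auto simp: fun_eq_iff)
    \<comment> \<open>\<open>Y\<close> is recovered from \<open>v = w^2 + w Y - 1\<close>, and \<open>X\<close> from the linear equation.\<close>
    define b where "b = (v + 1 - w ^ 2) / w"
    define a where "a = (2 + b ^ 2 + 2 * w * b + 2 * w ^ 2) / v"
    have wnz: "w \<noteq> 0" "v \<noteq> 0" using pair by (simp_all add: log_poisson_pair_def)
    have Y: "y + - 1 / y = b"
    proof -
      have "(y + - 1 / y) * w = v + 1 - w ^ 2"
        unfolding w_def v_def using nz by (simp add: divide_simps) algebra
      then show ?thesis unfolding b_def using wnz by (simp add: field_simps)
    qed
    have X: "x + 1 / x = a"
    proof -
      have "(x + 1 / x) * v = 2 + b ^ 2 + 2 * w * b + 2 * w ^ 2"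
        unfolding Y[symmetric] unfolding w_def v_def using nz by (simp add: divide_simps) algebra
      then show ?thesis unfolding a_def using wnz by (simp add: field_simps)
    qed
    have Z: "x * y + - 1 / (x * y) = b - w * (a - 2)"
      unfolding X[symmetric] Y[symmetric] w_def using nz by (simp add: divide_simps) algebra
    have b: "b \<in> range \<phi>"
      unfolding b_def using wv by (auto simp only: intro!: subfield_divide[OF K] subring_intros[OF KR])
    have a: "a \<in> range \<phi>"
      unfolding a_def using wv b by (auto simp only: intro!: subfield_divide[OF K] subring_intros[OF KR])
    show "\<sigma> f = f \<longleftrightarrow> f \<in> range \<phi>"
    proof
      assume f: "\<sigma> f = f"
      show "f \<in> range \<phi>"
      proof (rule involution_fixed[OF \<sigma>(1,2) _ _ K inv _ _ _ f, of "- 1"], unfold xy ratconst_m1 X Y Z)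
        show "a \<in> range \<phi>" "b \<in> range \<phi>" "b - w * (a - 2) \<in> range \<phi>"
          using wv a b by (auto simp only: intro!: subring_intros[OF KR])
      qed (use \<sigma> in \<open>simp_all add: xy\<close>)
    qed (rule inv)
  qed
qed

section \<open>Generators for the automorphism of order three\<close>

lemma primitive_cube_root:
  assumes "primitive_root_of_unity 3 (\<omega> :: 'a::field)"
  shows "\<omega> ^ 2 + \<omega> + 1 = 0"
proof -
  have "\<omega> ^ 3 = 1" "\<omega> ^ 1 \<noteq> 1" using assms unfolding primitive_root_of_unity_def by fastforce+
  then have "(\<omega> - 1) * (\<omega> ^ 2 + \<omega> + 1) = 0" "\<omega> - 1 \<noteq> 0"
    by (simp_all add: algebra_simps power2_eq_square power3_eq_cube)
  then show ?thesis by simp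
qed

text \<open>Let \<open>a\<close>, \<open>b\<close>, \<open>c\<close> be the three invariants of \<open>x \<mapsto> z \<mapsto> y \<mapsto> x\<close> used above, shifted by \<open>3\<close> so that the fixed
point \<open>x = y = 1\<close> goes to the origin. They satisfy a cubic equation \<open>F = 0\<close> that is singular at the
origin, and the brackets of the coordinates are the partial derivatives of \<open>F\<close> up to sign.
Projection from the origin makes the surface a plane with coordinates \<open>[a : b : c]\<close>; the form
acquires its poles along the nodal cubic \<open>a^3 + b^3 = a b c\<close> given by the leading part of \<open>F\<close>. The
slope \<open>u = b/a\<close> at the node and the equation \<open>v = (a^3 + b^3 - a b c)/a^3\<close> of the cubic satisfy
\<open>{u, v} = u v\<close> and generate the fixed field.

The inversion exchanges \<open>a\<close> and \<open>b\<close> and maps \<open>u\<close> to \<open>1/u\<close> and \<open>v\<close> to \<open>(u + 1/u - 1)^3 / v\<close>. A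
primitive cube root of unity \<open>\<zeta>\<close> splits \<open>u + 1/u - 1\<close> as \<open>(u + \<zeta>) (1/u + \<zeta>) / \<zeta>\<close>, so dividing
\<open>v\<close> by \<open>(u + 1/u - 1) (u + \<zeta>)\<close> and multiplying it by \<open>\<zeta>^2\<close> yields a generator \<open>w\<close> that is inverted.
A factor depending on \<open>u\<close> alone does not affect the bracket relation with \<open>u\<close>. This makes the
inversion on the fixed field an inversion of a rational function field again.\<close>

lemma order3_generators:
  fixes \<omega> :: "'a::field_char_0"
  assumes \<omega>: "primitive_root_of_unity 3 \<omega>"
  obtains \<phi> :: "'a ratfun2 \<Rightarrow> 'a ratfun2" where
    "alg_endo \<phi>" "log_poisson_pair (\<phi> ratX) (\<phi> ratY)"
    "\<And>\<sigma> f. alg_endo \<sigma> \<Longrightarrow> \<sigma> ratX = 1 / (ratX * ratY) \<Longrightarrow> \<sigma> ratY = ratX \<Longrightarrow> \<sigma> f = f \<longleftrightarrow> f \<in> range \<phi>"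
    "\<And>\<tau>. alg_endo \<tau> \<Longrightarrow> \<tau> ratX = 1 / ratX \<Longrightarrow> \<tau> ratY = 1 / ratY \<Longrightarrow>
       \<tau> (\<phi> ratX) = 1 / \<phi> ratX \<and> \<tau> (\<phi> ratY) = 1 / \<phi> ratY"
proof -
  define x y z :: "'a ratfun2" where "x = ratX" and "y = ratY" and "z = 1 / (ratX * ratY)"
  define \<zeta> :: "'a ratfun2" where "\<zeta> = ratconst \<omega>"
  have \<zeta>: "\<zeta> ^ 2 + \<zeta> + 1 = 0"
  proof -
    have "ratconst (\<omega> * \<omega> + \<omega> + 1) = 0"
      using primitive_cube_root[OF \<omega>] by (simp add: power2_eq_square rat_simps)
    then show ?thesis by (simp add: \<zeta>_def rat_simps power2_eq_square)
  qed
  have nz0: "x \<noteq> 0" "y \<noteq> 0" "z \<noteq> 0" by (simp_all add: x_def y_def z_def)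
  have z: "x * y * z = 1" by (simp add: x_def y_def z_def)
  have zxy: "z = 1 / (x * y)" by (simp add: x_def y_def z_def)
  have \<theta>: "theta_x x = x" "theta_x y = 0" "theta_y x = 0" "theta_y y = y"
    by (simp_all add: x_def y_def theta_simps)
  have \<theta>z: "theta_x z = - z" "theta_y z = - z"
    unfolding zxy using nz0
    by (simp_all add: deriv_divide[OF derivation_theta_x] deriv_divide[OF derivation_theta_y]
        theta_x_simps theta_y_simps \<theta> power2_eq_square)
  note tx = theta_x_simps \<theta> \<theta>z and ty = theta_y_simps \<theta> \<theta>z
  define a where "a = x + y + z - 3"
  define b where "b = x * y + y * z + z * x - 3"
  define c where "c = x ^ 2 * y + y ^ 2 * z + z ^ 2 * x - 3"
  define F where "F = c ^ 2 - 9 * a * b - 3 * a * c - 3 * b * c + 9 * a ^ 2 + 9 * b ^ 2 + a ^ 3 + b ^ 3 - a * b * c"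
  have F: "F = 0"
    unfolding F_def a_def b_def c_def using z by algebra
  have br_ab: "poisson_br a b = a * b + 3 * a + 3 * b - 2 * c"
    unfolding br_theta unfolding a_def b_def c_def using z
    by (simp add: tx ty) algebra
  have br_bc: "poisson_br b c = 9 * b + 3 * c - 18 * a - 3 * a ^ 2 + b * c"
    unfolding br_theta unfolding a_def b_def c_def using z
    by (simp add: tx ty) algebra
  have br_ca: "poisson_br c a = 9 * a + 3 * c - 18 * b - 3 * b ^ 2 + a * c"
    unfolding br_theta unfolding a_def b_def c_def using z
    by (simp add: tx ty) algebra
  \<comment> \<open>No combination \<open>b + k a\<close> vanishes: an Euler operator turns it into \<open>(x - z) (y + k)\<close>.\<close>
  have xz: "x - z \<noteq> 0"
  proof
    assume "x - z = 0"
    then have "z = x" by simp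
    then have "x ^ 2 * y - 1 = 0" using z by (simp add: power2_eq_square mult_ac)
    then have "theta_x (x ^ 2 * y - 1) = 0" by (simp add: tx)
    then show False using nz0 by (simp add: tx two_nz)
  qed
  have lin_nz: "b + ratconst k * a \<noteq> 0" for k
  proof
    assume "b + ratconst k * a = 0"
    then have "theta_x (b + ratconst k * a) = 0" by (simp add: tx)
    then have "(x - z) * (y + ratconst k) = 0"
      unfolding a_def b_def by (simp add: tx algebra_simps)
    with xz have "y + ratconst k = 0" by simp
    then have "theta_y (y + ratconst k) = 0" by (simp add: ty)
    then show False using nz0 by (simp add: ty)
  qed
  have b: "b \<noteq> 0" using lin_nz[of 0] by (simp add: rat_simps)
  have a: "a \<noteq> 0"
  proof
    assume "a = 0"
    then have "theta_x a = 0" by (simp add: tx)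
    then show False using xz by (simp add: a_def tx)
  qed
  define u C where "u = b / a" and "C = c / a"
  define v where "v = 1 + u ^ 3 - u * C"
  define q where "q = u ^ 2 - u + 1"
  have u: "u \<noteq> 0" using a b by (simp add: u_def)
  have u_lin: "u + ratconst k \<noteq> 0" for k
    using lin_nz[of k] a by (simp add: u_def field_simps)
  have "q = (u + \<zeta>) * (u + ratconst (\<omega> ^ 2))"
    using \<zeta> unfolding q_def \<zeta>_def by (simp add: power2_eq_square rat_simps) algebra
  then have q: "q \<noteq> 0" using u_lin by (simp add: \<zeta>_def)
  have u\<zeta>: "u + \<zeta> \<noteq> 0" using u_lin by (simp add: \<zeta>_def)
  have v_alt: "v = (a ^ 3 + b ^ 3 - a * b * c) / a ^ 3"
    unfolding v_def u_def C_def using a by (simp add: divide_simps) algebra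
  \<comment> \<open>On the line through the origin with direction \<open>(1, u, C)\<close> the equation \<open>F = 0\<close> is linear in
    \<open>a\<close>, after division by \<open>a^2\<close>.\<close>
  have a_alt: "a * v = - (C ^ 2 - 9 * u - 3 * C - 3 * u * C + 9 + 9 * u ^ 2)"
  proof -
    have "a ^ 2 * (a * v + (C ^ 2 - 9 * u - 3 * C - 3 * u * C + 9 + 9 * u ^ 2)) = F"
      unfolding v_def u_def C_def F_def using a by (simp add: divide_simps) algebra
    then have "a * v + (C ^ 2 - 9 * u - 3 * C - 3 * u * C + 9 + 9 * u ^ 2) = 0" using F a by simp
    then show ?thesis by (simp only: eq_neg_iff_add_eq_0)
  qed
  \<comment> \<open>\<open>c'\<close> and \<open>v'\<close> are the images of \<open>c\<close> and \<open>v\<close> under the inversion.\<close>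
  define c' where "c' = a * b + 3 * a + 3 * b - c"
  define v' where "v' = (b ^ 3 + a ^ 3 - b * a * c') / b ^ 3"
  have vv': "v * v' = (q / u) ^ 3"
  proof -
    have "(a ^ 3 + b ^ 3 - a * b * c) * (b ^ 3 + a ^ 3 - b * a * c') = (a ^ 2 - a * b + b ^ 2) ^ 3"
      using F unfolding F_def c'_def by algebra
    then have "v * v' = (a ^ 2 - a * b + b ^ 2) ^ 3 / (a ^ 3 * b ^ 3)"
      unfolding v_alt v'_def by simp
    also have "\<dots> = ((a ^ 2 - a * b + b ^ 2) / (a * b)) ^ 3"
      by (simp add: power_divide power_mult_distrib)
    also have "(a ^ 2 - a * b + b ^ 2) / (a * b) = q / u"
      unfolding q_def u_def using a b by (simp add: divide_simps) algebra
    finally show ?thesis .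
  qed
  then have v: "v \<noteq> 0" using q u by auto
  define w where "w = v * (\<zeta> ^ 2 * u / (q * (u + \<zeta>)))"
  have \<zeta>0: "\<zeta> \<noteq> 0" using \<zeta> by auto
  have br_uC: "poisson_br u C = - v"
  proof -
    have ba: "poisson_br b a = - poisson_br a b" and ac: "poisson_br a c = - poisson_br c a"
      by (rule br_anti)+
    \<comment> \<open>With brackets given by partial derivatives of \<open>F\<close>, the numerator is an Euler sum
      \<open>a F_a + b F_b + c F_c\<close>, which on \<open>F = 0\<close> leaves the cubic part.\<close>
    have "poisson_br u C = (a * poisson_br b c + b * poisson_br c a + c * poisson_br a b) / a ^ 3"
      unfolding u_def C_def using a
      by (simp add: deriv_divide[OF derivation_br_left] deriv_divide[OF derivation_br_right]
          br_self ba ac divide_simps) algebra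
    also have "a * poisson_br b c + b * poisson_br c a + c * poisson_br a b = - (a ^ 3 + b ^ 3 - a * b * c)"
      unfolding br_ab br_bc br_ca using F unfolding F_def by algebra
    finally show ?thesis by (simp only: v_alt minus_divide_left)
  qed
  note bu = deriv_simps[OF derivation_br_right[of u]] deriv_divide[OF derivation_br_right[of u]] br_self
  have "poisson_br u (\<zeta> ^ 2 * u / (q * (u + \<zeta>))) = 0"
    using q u\<zeta> unfolding q_def \<zeta>_def by (simp add: bu)
  moreover have "poisson_br u v = u * v"
    unfolding v_def[THEN arg_cong[of _ _ "poisson_br u"]] by (simp add: bu br_uC)
  ultimately have br_uw: "poisson_br u w = u * w"
    unfolding w_def by (simp only: deriv_mult[OF derivation_br_right]) simp
  have w: "w \<noteq> 0" using v q u u\<zeta> \<zeta>0 by (simp add: w_def)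
  have pair: "log_poisson_pair w u" using w u br_uw by (simp add: log_poisson_pair_def)
  obtain \<phi> where \<phi>: "alg_endo \<phi>" "\<phi> ratX = w" "\<phi> ratY = u" using log_poisson_pair_substitution[OF pair] .
  have K: "subfield_of (range \<phi>)" by (rule subfield_range[OF \<phi>(1)])
  note KR = subfield_subring[OF K]
  note closed = subfield_divide[OF K] subring_intros[OF KR]
  have wu: "w \<in> range \<phi>" "u \<in> range \<phi>" using \<phi>(2,3) by (metis rangeI)+
  have abc_K: "a \<in> range \<phi>" "b \<in> range \<phi>" "c \<in> range \<phi>"
  proof -
    have \<zeta>K: "\<zeta> \<in> range \<phi>" unfolding \<zeta>_def by (rule subring_const[OF KR])
    have "w * (q * (u + \<zeta>)) / (\<zeta> ^ 2 * u) \<in> range \<phi>"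
      unfolding q_def using wu \<zeta>K by (auto simp only: intro!: closed)
    moreover have "w * (q * (u + \<zeta>)) / (\<zeta> ^ 2 * u) = v"
      unfolding w_def using q u u\<zeta> \<zeta>0 by simp
    ultimately have vK: "v \<in> range \<phi>" by simp
    have "(1 + u ^ 3 - v) / u \<in> range \<phi>" using wu vK by (auto simp only: intro!: closed)
    moreover have "(1 + u ^ 3 - v) / u = C" using u by (simp add: v_def)
    ultimately have CK: "C \<in> range \<phi>" by simp
    have "- (C ^ 2 - 9 * u - 3 * C - 3 * u * C + 9 + 9 * u ^ 2) / v \<in> range \<phi>"
      using wu vK CK by (auto simp only: intro!: closed)
    then show aK: "a \<in> range \<phi>" unfolding a_alt[symmetric] using v by simp
    have "u * a \<in> range \<phi>" "C * a \<in> range \<phi>" using wu aK CK by (auto simp only: intro!: closed)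
    then show "b \<in> range \<phi>" "c \<in> range \<phi>" unfolding u_def C_def using a by simp_all
  qed
  show ?thesis
  proof (rule that[OF \<phi>(1)])
    show "log_poisson_pair (\<phi> ratX) (\<phi> ratY)" using pair \<phi> by simp
  next
    fix \<sigma> :: "'a ratfun2 \<Rightarrow> 'a ratfun2" and f
    assume \<sigma>: "alg_endo \<sigma>" "\<sigma> ratX = 1 / (ratX * ratY)" "\<sigma> ratY = ratX"
    note e = endo_simps[OF \<sigma>(1)]
    have \<sigma>xyz: "\<sigma> x = z" "\<sigma> y = x" "\<sigma> z = y"
      unfolding zxy e by (simp_all add: \<sigma> x_def y_def)
    have "\<sigma> a = a" "\<sigma> b = b" "\<sigma> c = c"
      unfolding a_def b_def c_def e \<sigma>xyz by (simp_all add: algebra_simps)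
    then have "\<sigma> w = w" "\<sigma> u = u"
      unfolding w_def q_def v_def C_def u_def \<zeta>_def e by simp_all
    then have "\<sigma> \<circ> \<phi> = \<phi>"
      by (intro alg_endo_ext) (simp_all add: alg_endo_comp \<sigma> \<phi>)
    then have inv: "\<sigma> g = g" if "g \<in> range \<phi>" for g using that by (auto simp: fun_eq_iff)
    show "\<sigma> f = f \<longleftrightarrow> f \<in> range \<phi>"
    proof
      assume f: "\<sigma> f = f"
      show "f \<in> range \<phi>"
      proof (rule order3_fixed[OF \<sigma> K inv _ _ _ f])
        have "a + 3 \<in> range \<phi>" "b + 3 \<in> range \<phi>" "c + 3 \<in> range \<phi>"
          using abc_K by (auto simp only: intro!: closed)
        then show "ratX + ratY + 1 / (ratX * ratY) \<in> range \<phi>"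
          "ratX * ratY + ratY * (1 / (ratX * ratY)) + 1 / (ratX * ratY) * ratX \<in> range \<phi>"
          "ratX ^ 2 * ratY + ratY ^ 2 * (1 / (ratX * ratY)) + (1 / (ratX * ratY)) ^ 2 * ratX \<in> range \<phi>"
          unfolding a_def b_def c_def x_def y_def z_def by (simp_all only: diff_add_cancel)
      qed
    qed (rule inv)
  next
    fix \<tau> :: "'a ratfun2 \<Rightarrow> 'a ratfun2"
    assume \<tau>: "alg_endo \<tau>" "\<tau> ratX = 1 / ratX" "\<tau> ratY = 1 / ratY"
    note e = endo_simps[OF \<tau>(1)]
    have \<tau>xyz: "\<tau> x = y * z" "\<tau> y = z * x" "\<tau> z = x * y"
      unfolding zxy e by (simp_all add: \<tau> x_def y_def)
    have \<tau>abc: "\<tau> a = b" "\<tau> b = a" "\<tau> c = c'"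
      unfolding c'_def a_def b_def c_def e \<tau>xyz using z by - algebra+
    have \<tau>u: "\<tau> u = 1 / u" unfolding u_def e \<tau>abc by simp
    have \<tau>v: "\<tau> v = v'" unfolding v_alt v'_def e \<tau>abc by simp
    have q': "(1 / u) ^ 2 - 1 / u + 1 = q / u ^ 2"
      unfolding q_def using u by (simp add: divide_simps) algebra
    have \<zeta>': "1 / u + \<zeta> = \<zeta> * q / (u * (u + \<zeta>))"
      unfolding q_def using u u\<zeta> \<zeta> by (simp add: divide_simps) algebra
    have "w * \<tau> w = (v * v') * (\<zeta> ^ 2 * u / (q * (u + \<zeta>)))
        * (\<zeta> ^ 2 * (1 / u) / ((q / u ^ 2) * (\<zeta> * q / (u * (u + \<zeta>)))))"
      unfolding w_def e \<tau>v q_def[THEN arg_cong[of _ _ \<tau>]] \<tau>u q' using \<zeta>'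
      by (simp add: \<zeta>_def e)
    also have "\<dots> = \<zeta> ^ 3"
      unfolding vv' using q u u\<zeta> \<zeta>0 by (simp add: divide_simps) algebra
    also have "\<zeta> ^ 3 = 1" using \<zeta> by algebra
    finally have "\<tau> w = 1 / w" using w by (simp add: field_simps)
    then show "\<tau> (\<phi> ratX) = 1 / \<phi> ratX \<and> \<tau> (\<phi> ratY) = 1 / \<phi> ratY"
      using \<tau>u \<phi> by simp
  qed
qed

section \<open>Monomial automorphisms as matrices\<close>

definition mat2 :: "int \<Rightarrow> int \<Rightarrow> int \<Rightarrow> int \<Rightarrow> int^2^2" where
  "mat2 a b c d = (\<chi> i j. if i = 1 then (if j = 1 then a else b) else (if j = 1 then c else d))"

lemma mat2_nth [simp]:
  "mat2 a b c d $ 1 $ 1 = a" "mat2 a b c d $ 1 $ 2 = b"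
  "mat2 a b c d $ 2 $ 1 = c" "mat2 a b c d $ 2 $ 2 = d"
  by (simp_all add: mat2_def)

lemma mat2_eta: "mat2 (g$1$1) (g$1$2) (g$2$1) (g$2$2) = g"
  by (simp add: vec_eq_iff forall_2)

lemma mat2_eq_iff [simp]:
  "mat2 a b c d = mat2 a' b' c' d' \<longleftrightarrow> a = a' \<and> b = b' \<and> c = c' \<and> d = d'"
  by (metis mat2_nth)

lemma det_mat2 [simp]: "det (mat2 a b c d) = a * d - b * c"
  by (simp add: det_2)

lemma mat2_mult [simp]:
  "mat2 a b c d ** mat2 a' b' c' d' = mat2 (a * a' + b * c') (a * b' + b * d') (c * a' + d * c') (c * b' + d * d')"
  by (simp add: vec_eq_iff forall_2 matrix_matrix_mult_def sum_2)

lemma mat_1_mat2: "mat 1 = mat2 1 0 0 1"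
  by (simp add: vec_eq_iff forall_2 mat_def)

lemma mat2_cases:
  obtains a b c d where "g = mat2 a b c d"
  using mat2_eta[of g] by metis

lemma monomial_aut_endo: "det g \<noteq> 0 \<Longrightarrow> alg_endo (monomial_aut g)"
  and monomial_aut_Y: "det g \<noteq> 0 \<Longrightarrow> monomial_aut g ratY = ratY powi (g$1$1) * ratX powi (g$2$1)"
  and monomial_aut_X: "det g \<noteq> 0 \<Longrightarrow> monomial_aut g ratX = ratY powi (g$1$2) * ratX powi (g$2$2)"
  unfolding monomial_aut_def using theI'[OF monomial_aut_ex1[of g]] by blast+

lemma monomial_aut_mult:
  fixes f :: "'a::field ratfun2"
  assumes g: "det g \<noteq> 0" and h: "det h \<noteq> 0"
  shows "monomial_aut (g ** h) f = monomial_aut g (monomial_aut h f)"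
proof -
  have gh: "det (g ** h) \<noteq> 0" using g h by (simp add: det_mul)
  have entries: "(g ** h)$i$j = g$i$1 * h$1$j + g$i$2 * h$2$j" for i j
    by (simp add: matrix_matrix_mult_def sum_2)
  have "(monomial_aut (g ** h) :: 'a ratfun2 \<Rightarrow> _) = monomial_aut g \<circ> monomial_aut h"
    by (rule alg_endo_ext)
       (simp_all add: monomial_aut_endo monomial_aut_X monomial_aut_Y g h gh alg_endo_comp
          endo_mult[OF monomial_aut_endo] endo_power_int[OF monomial_aut_endo] entries
          power_int_add power_int_mult power_int_mult_distrib)
  then show ?thesis by simp
qed

lemma monomial_aut_1: "monomial_aut (mat 1) f = f" for f :: "'a::field ratfun2"
proof -
  have "(monomial_aut (mat 1) :: 'a ratfun2 \<Rightarrow> _) = (\<lambda>f. f)"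
    by (rule alg_endo_ext)
       (simp_all add: mat_1_mat2 monomial_aut_endo monomial_aut_X monomial_aut_Y alg_endo_id)
  then show ?thesis by simp
qed

lemma deriv_power_int:
  assumes D: "is_derivation D" and f: "f \<noteq> 0"
  shows "D (f powi n) = of_int n * f powi n * (D f / f)"
proof -
  have pow: "D (g ^ k) = of_nat k * g ^ k * (D g / g)" if "g \<noteq> 0" for g k
    by (induction k) (simp_all add: deriv_mult[OF D] deriv_1[OF D] that field_simps)
  have inv: "D (1 / f) / (1 / f) = - (D f / f)"
    using f by (simp add: deriv_divide[OF D] deriv_simps[OF D] power2_eq_square)
  show ?thesis
  proof (cases "n \<ge> 0")
    case True
    then show ?thesis using pow[OF f, of "nat n"] by (simp add: power_int_def)
  next
    case False
    then have "D (f powi n) = D ((1 / f) ^ nat (- n))" by (simp add: power_int_def inverse_eq_divide)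
    also have "\<dots> = of_nat (nat (- n)) * (1 / f) ^ nat (- n) * - (D f / f)"
      using pow[of "1 / f" "nat (- n)"] f unfolding inv by simp
    finally show ?thesis using False by (simp add: power_int_def inverse_eq_divide)
  qed
qed

lemma theta_monomial:
  fixes i j :: int
  shows "theta_x (ratY powi i * ratX powi j) = of_int j * (ratY powi i * ratX powi j)"
  "theta_y (ratY powi i * ratX powi j) = of_int i * (ratY powi i * ratX powi j)"
  by (simp_all add: deriv_mult[OF derivation_theta_x] deriv_mult[OF derivation_theta_y]
      deriv_power_int[OF derivation_theta_x] deriv_power_int[OF derivation_theta_y] theta_simps)

text \<open>The bracket of two monomials is the determinant of their exponents times their product.\<close>

lemma monomial_aut_pair:
  assumes "det g = 1"
  shows "log_poisson_pair (monomial_aut g ratX) (monomial_aut g (ratY :: 'a::field ratfun2))"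
proof -
  have g: "det g \<noteq> 0" using assms by simp
  define m n :: "'a ratfun2" where
    "m = ratY powi (g$1$1) * ratX powi (g$2$1)" and "n = ratY powi (g$1$2) * ratX powi (g$2$2)"
  have "poisson_br m n = of_int (g$1$1 * g$2$2 - g$2$1 * g$1$2) * (m * n)"
    unfolding br_theta m_def n_def theta_monomial unfolding m_def[symmetric] n_def[symmetric]
    by (simp add: algebra_simps)
  moreover have "g$1$1 * g$2$2 - g$2$1 * g$1$2 = 1" using assms by (simp add: det_2 mult.commute)
  moreover have "m \<noteq> 0" "n \<noteq> 0" by (simp_all add: m_def n_def)
  ultimately show ?thesis
    unfolding log_poisson_pair_def monomial_aut_X[OF g] monomial_aut_Y[OF g]
      m_def[symmetric] n_def[symmetric] by simp
qed

lemma fixed_fieldI: "(\<And>g. g \<in> G \<Longrightarrow> monomial_aut g f = f) \<Longrightarrow> f \<in> fixed_field G"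
  by (simp add: fixed_field_def)

section \<open>Finite subgroups of \<open>SL\<^sub>2(\<int>)\<close>\<close>

text \<open>In a finite set of invertible matrices closure under products already gives a group; this form
avoids inverse matrices.\<close>

definition finite_sl2 :: "(int^2^2) set \<Rightarrow> bool" where
  "finite_sl2 G \<longleftrightarrow> finite G \<and> mat 1 \<in> G \<and> (\<forall>g\<in>G. det g = 1 \<and> (\<forall>h\<in>G. g ** h \<in> G))"

text \<open>By the theorem of Cayley and Hamilton \<open>g^2 = t g - 1\<close> for an element of trace \<open>t\<close>. Hence \<open>g^2\<close> has
trace \<open>t^2 - 2\<close>, which exceeds \<open>t\<close> in absolute value if \<open>\<bar>t\<bar> \<ge> 3\<close>: an element with trace of maximal
absolute value excludes this. For \<open>t = 2\<close> squaring keeps the trace and doubles the off-diagonal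
entries, so these vanish by the same maximality argument; for \<open>t = - 2\<close> one passes to the square.\<close>

lemma finite_sl2_elements:
  assumes G: "finite_sl2 G" and g: "mat2 a b c d \<in> G"
  shows "\<bar>a + d\<bar> \<le> 1 \<or> mat2 a b c d = mat2 1 0 0 1 \<or> mat2 a b c d = mat2 (- 1) 0 0 (- 1)"
proof -
  have det: "a * d - b * c = 1" if "mat2 a b c d \<in> G" for a b c d
    using G that unfolding finite_sl2_def by fastforce
  have sq: "mat2 (a * a + b * c) (b * (a + d)) (c * (a + d)) (d * d + b * c) \<in> G"
    if "mat2 a b c d \<in> G" for a b c d
  proof -
    have "mat2 a b c d ** mat2 a b c d \<in> G" using G that unfolding finite_sl2_def by blast
    then show ?thesis by (simp add: algebra_simps)
  qed
  have bounded: "\<exists>g\<in>H. \<forall>h\<in>H. N h \<le> N g" if "H \<subseteq> G" "H \<noteq> {}" for H and N :: "int^2^2 \<Rightarrow> int"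
  proof -
    have "finite (N ` H)" using G that finite_subset unfolding finite_sl2_def by blast
    then have "Max (N ` H) \<in> N ` H" "\<forall>h\<in>H. N h \<le> Max (N ` H)" using that by auto
    then show ?thesis by force
  qed
  have tr: "\<bar>a + d\<bar> \<le> 2" if abcd: "mat2 a b c d \<in> G" for a b c d
  proof -
    obtain g where g: "g \<in> G" "\<forall>h\<in>G. \<bar>h$1$1 + h$2$2\<bar> \<le> \<bar>g$1$1 + g$2$2\<bar>"
      using bounded[of G "\<lambda>h. \<bar>h$1$1 + h$2$2\<bar>"] abcd by blast
    obtain p q r s where pqrs: "g = mat2 p q r s" by (rule mat2_cases)
    have "\<bar>p * p + q * r + (s * s + q * r)\<bar> \<le> \<bar>p + s\<bar>" using g(2) sq[of p q r s] g(1) pqrs by fastforce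
    moreover have "p * p + q * r + (s * s + q * r) = (p + s) * (p + s) - 2"
      using det[of p q r s] g(1) pqrs by (simp add: algebra_simps)
    ultimately have "\<bar>p + s\<bar> * \<bar>p + s\<bar> \<le> \<bar>p + s\<bar> + 2" by (simp add: abs_mult_self_eq)
    moreover have "3 * \<bar>p + s\<bar> \<le> \<bar>p + s\<bar> * \<bar>p + s\<bar>" if "3 \<le> \<bar>p + s\<bar>"
      using that by (intro mult_right_mono) auto
    ultimately have "\<bar>p + s\<bar> \<le> 2" by fastforce
    then show ?thesis using g(2) abcd pqrs by fastforce
  qed
  have tr2: "b = 0 \<and> c = 0" if abcd: "mat2 a b c d \<in> G" "a + d = 2" for a b c d
  proof -
    let ?H = "{h \<in> G. h$1$1 + h$2$2 = 2}"
    have "N (mat2 a b c d) = 0" if N: "N = (\<lambda>h. \<bar>h$1$2\<bar>) \<or> N = (\<lambda>h. \<bar>h$2$1\<bar>)" for N :: "int^2^2 \<Rightarrow> int"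
    proof -
      obtain g where g: "g \<in> ?H" "\<forall>h\<in>?H. N h \<le> N g"
        using bounded[of ?H N] abcd by force
      obtain p q r s where pqrs: "g = mat2 p q r s" by (rule mat2_cases)
      let ?g2 = "mat2 (p * p + q * r) (q * (p + s)) (r * (p + s)) (s * s + q * r)"
      have "p * s - q * r = 1" using det[of p q r s] g(1) pqrs by simp
      then have "p * p + q * r + (s * s + q * r) = (p + s) * (p + s) - 2"
        by (simp add: algebra_simps)
      moreover have "p + s = 2" using g(1) pqrs by simp
      ultimately have "p * p + q * r + (s * s + q * r) = 2" by simp
      then have "?g2 \<in> ?H" using sq[of p q r s] g(1) pqrs by simp
      then have "N ?g2 \<le> N g" using g(2) by blast
      moreover have "N ?g2 = 2 * N g" using N pqrs g(1) by (auto simp: abs_mult)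
      moreover have "N (mat2 a b c d) \<le> N g" using g(2) abcd by simp
      moreover have "0 \<le> N (mat2 a b c d)" using N by auto
      ultimately show ?thesis by linarith
    qed
    from this[of "\<lambda>h. \<bar>h$1$2\<bar>"] this[of "\<lambda>h. \<bar>h$2$1\<bar>"] show ?thesis by simp
  qed
  consider "\<bar>a + d\<bar> \<le> 1" | "a + d = 2" | "a + d = - 2" using tr[OF g] by linarith
  then show ?thesis
  proof cases
    case 2
    then have bc: "b = 0" "c = 0" using tr2[OF g] by auto
    have d: "d = 2 - a" using 2 by simp
    have "a * (2 - a) = 1" using det[OF g] bc unfolding d by simp
    then have "(a - 1) * (a - 1) = 0" by (simp add: algebra_simps)
    then show ?thesis using bc 2 by simp
  next
    case 3
    have "a * a + b * c + (d * d + b * c) = (a + d) * (a + d) - 2"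
      using det[OF g] by (simp add: algebra_simps)
    then have bc: "b = 0" "c = 0" using tr2[OF sq[OF g]] 3 by auto
    have d: "d = - 2 - a" using 3 by simp
    have "a * (- 2 - a) = 1" using det[OF g] bc unfolding d by simp
    then have "(a + 1) * (a + 1) = 0" by (simp add: algebra_simps)
    then show ?thesis using bc 3 by simp
  qed simp
qed

text \<open>For \<open>g = [p, q; r, s]\<close> and the companion matrix \<open>S\<close> of trace \<open>t\<close>, the three bounded quantities are
the traces \<open>\<alpha>\<close>, \<open>\<beta>\<close> of \<open>g\<close>, \<open>S g\<close> and that of \<open>S^2 g = t S g - g\<close>. The quadratic form
\<open>\<alpha>^2 - t \<alpha> \<beta> + \<beta>^2\<close> exceeds \<open>(4 - t^2) det g\<close> by a sum of squares, namely by a multiple of the norm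
of the part of \<open>g\<close> that does not commute with \<open>S\<close>. Traces of absolute value at most \<open>1\<close> cannot
reach this value.\<close>

lemma companion_power_bound:
  fixes p q r s t :: int
  assumes "p * s - q * r = 1" "\<bar>t\<bar> \<le> 1"
    "\<bar>p + s\<bar> \<le> 1" "\<bar>q + t * s - r\<bar> \<le> 1" "\<bar>t * (q + t * s - r) - (p + s)\<bar> \<le> 1"
  shows False
proof -
  define \<alpha> \<beta> where "\<alpha> = p + s" and "\<beta> = q + t * s - r"
  have range: "t \<in> {-1, 0, 1}" "\<alpha> \<in> {-1, 0, 1}" "\<beta> \<in> {-1, 0, 1}"
    using assms by (auto simp: \<alpha>_def \<beta>_def)
  have "4 * (\<alpha> * \<alpha> - t * \<alpha> * \<beta> + \<beta> * \<beta> - (4 - t * t) * (p * s - q * r))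
      = (2 * (p - s) - t * (q - r)) ^ 2 + (4 - t * t) * (q + r) ^ 2"
    using range(1) unfolding \<alpha>_def \<beta>_def
    by (auto simp: power2_eq_square algebra_simps)
  moreover have "0 \<le> (4 - t * t) * (q + r) ^ 2" using range(1) by auto
  moreover have "0 \<le> (2 * (p - s) - t * (q - r)) ^ 2" by (rule zero_le_power2)
  ultimately have "0 \<le> 4 * (\<alpha> * \<alpha> - t * \<alpha> * \<beta> + \<beta> * \<beta> - (4 - t * t) * (p * s - q * r))"
    by linarith
  then have "4 - t * t \<le> \<alpha> * \<alpha> - t * \<alpha> * \<beta> + \<beta> * \<beta>"
    unfolding assms(1) by simp
  moreover have "\<bar>t * \<beta> - \<alpha>\<bar> \<le> 1" using assms(5) by (simp add: \<alpha>_def \<beta>_def)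
  ultimately show False using range by auto
qed


section \<open>Conjugation to companion matrices\<close>

definition sl2_conj :: "int^2^2 \<Rightarrow> int^2^2 \<Rightarrow> bool" where
  "sl2_conj g g' \<longleftrightarrow> (\<exists>h. det h = 1 \<and> h ** g = g' ** h)"

lemma sl2_conj_trans: "sl2_conj g g' \<Longrightarrow> sl2_conj g' g'' \<Longrightarrow> sl2_conj g g''"
proof -
  assume "sl2_conj g g'" "sl2_conj g' g''"
  then obtain h k where "det h = 1" "h ** g = g' ** h" "det k = 1" "k ** g' = g'' ** k"
    by (auto simp: sl2_conj_def)
  then have "det (k ** h) = 1" "(k ** h) ** g = g'' ** (k ** h)"
    by (simp_all add: det_mul) (metis matrix_mul_assoc)
  then show ?thesis by (auto simp: sl2_conj_def)
qed

lemma sl2_conj_shift: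
  "sl2_conj (mat2 a b c d) (mat2 (a + k * c) (b + k * (d - a) - k * k * c) c (d - k * c))"
  unfolding sl2_conj_def by (rule exI[of _ "mat2 1 k 0 1"]) (simp add: algebra_simps)

lemma sl2_conj_swap: "sl2_conj (mat2 a b c d) (mat2 d (- c) (- b) a)"
  unfolding sl2_conj_def by (rule exI[of _ "mat2 0 (- 1) 1 0"]) simp

lemma sl2_conj_companion_unit:
  assumes "a * d - b * c = 1" "\<bar>c\<bar> = 1"
  shows "sl2_conj (mat2 a b c d) (mat2 0 (- c) c (a + d))"
proof -
  have cc: "c * c = 1" using assms(2) by (auto simp: abs_if split: if_splits)
  have e1: "b + - (a * c) * (d - a) - - (a * c) * - (a * c) * c = - c * (a * d - b * c)"
    using cc by algebra
  have e2: "a + - (a * c) * c = 0" and e3: "d - - (a * c) * c = a + d" using cc by - algebra+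
  show ?thesis
    using sl2_conj_shift[of a b c d "- (a * c)"] by (simp only: e1 e2 e3 assms(1)) simp
qed

lemma centred_remainder:
  fixes n c :: int
  assumes "c \<noteq> 0"
  obtains k where "\<bar>n + 2 * (k * c)\<bar> \<le> \<bar>c\<bar>"
proof -
  define m where "m = \<bar>c\<bar>"
  define r where "r = (n + m) mod (2 * m)"
  have m: "0 < m" using assms by (simp add: m_def)
  have r: "0 \<le> r" "r < 2 * m" using m by (simp_all add: r_def)
  have "n + m = 2 * m * ((n + m) div (2 * m)) + r" by (simp add: r_def)
  then have "n + 2 * (- (((n + m) div (2 * m)) * sgn c) * c) = r - m"
    by (simp add: m_def abs_sgn algebra_simps)
  moreover have "\<bar>r - m\<bar> \<le> m" using r by linarith
  ultimately show ?thesis using that unfolding m_def by metis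
qed

text \<open>This is reduction of binary quadratic forms, by descent on the lower left entry \<open>c\<close>. A shear makes
the difference of the diagonal entries at most \<open>\<bar>c\<bar>\<close> in absolute value. Since
\<open>4 b c = t^2 - 4 - (a - d)^2\<close>, either the upper right entry is then smaller than \<open>\<bar>c\<bar>\<close>, and exchanging
the two entries makes progress, or \<open>3 c^2 \<le> 4\<close>, so that \<open>c\<close> is a unit and a shear clears the upper
left entry.\<close>

lemma sl2_conj_companion:
  assumes "a * d - b * c = 1" "\<bar>a + d\<bar> \<le> 1"
  shows "\<exists>e\<in>{1, -1}. sl2_conj (mat2 a b c d) (mat2 0 (- e) e (a + d))"
  using assms
proof (induction "nat \<bar>c\<bar>" arbitrary: a b c d rule: less_induct)
  case less
  have c: "c \<noteq> 0"
  proof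
    assume "c = 0"
    then have "a * d = 1" using less.prems by simp
    then have "a = 1 \<and> d = 1 \<or> a = - 1 \<and> d = - 1" by (simp add: zmult_eq_1_iff)
    then show False using less.prems by auto
  qed
  obtain k where k: "\<bar>(a - d) + 2 * (k * c)\<bar> \<le> \<bar>c\<bar>" using centred_remainder[OF c] .
  define a' b' d' where "a' = a + k * c" and "b' = b + k * (d - a) - k * k * c" and "d' = d - k * c"
  have conj1: "sl2_conj (mat2 a b c d) (mat2 a' b' c d')"
    unfolding a'_def b'_def d'_def by (rule sl2_conj_shift)
  have tr: "a' + d' = a + d" by (simp add: a'_def d'_def)
  have det: "a' * d' - b' * c = 1"
    using less.prems(1) unfolding a'_def b'_def d'_def by (simp add: algebra_simps)
  have diff: "\<bar>a' - d'\<bar> \<le> \<bar>c\<bar>" using k by (simp add: a'_def d'_def algebra_simps)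
  show ?case
  proof (cases "\<bar>b'\<bar> < \<bar>c\<bar>")
    case True
    have "\<exists>e\<in>{1, -1}. sl2_conj (mat2 d' (- c) (- b') a') (mat2 0 (- e) e (d' + a'))"
      by (rule less.hyps) (use True det tr less.prems in \<open>auto simp: algebra_simps\<close>)
    moreover have "sl2_conj (mat2 a b c d) (mat2 d' (- c) (- b') a')"
      using conj1 sl2_conj_swap sl2_conj_trans by blast
    ultimately show ?thesis using sl2_conj_trans tr by (metis add.commute)
  next
    case False
    have "4 * (b' * c) = (a + d) * (a + d) - 4 - (a' - d') * (a' - d')"
      using det unfolding tr[symmetric] by (simp add: algebra_simps)
    moreover have "(a' - d') * (a' - d') \<le> c * c"
      using abs_le_square_iff[of "a' - d'" c] diff by (simp add: power2_eq_square)
    moreover have "c * c \<le> \<bar>b' * c\<bar>"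
      using False mult_right_mono[of "\<bar>c\<bar>" "\<bar>b'\<bar>" "\<bar>c\<bar>"] by (simp add: abs_mult)
    moreover have "0 \<le> (a + d) * (a + d)" "(a + d) * (a + d) \<le> 1"
      using less.prems(2) by (auto simp: abs_le_iff abs_square_le_1 simp flip: power2_eq_square)
    moreover have "0 \<le> (a' - d') * (a' - d')" by simp
    ultimately have "c * c < 4" by linarith
    moreover have "2 * 2 \<le> \<bar>c\<bar> * \<bar>c\<bar>" if "2 \<le> \<bar>c\<bar>"
      using that by (intro mult_mono) auto
    ultimately have "\<bar>c\<bar> < 2" by fastforce
    then have c1: "\<bar>c\<bar> = 1" using c by linarith
    then have "c \<in> {1, -1}" by auto
    moreover have "sl2_conj (mat2 a b c d) (mat2 0 (- c) c (a + d))"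
      using sl2_conj_companion_unit[OF less.prems(1) c1] .
    ultimately show ?thesis by blast
  qed
qed

section \<open>Fixed fields of finite subgroups\<close>

text \<open>The embedding of \<open>k(x, y)\<close> with image \<open>A\<close> is the inverse of the isomorphism that is finally
wanted. Embeddings are used because they are total and compose.\<close>

definition log_rational :: "'a::field ratfun2 set \<Rightarrow> bool" where
  "log_rational A \<longleftrightarrow> (\<exists>\<phi>. alg_endo \<phi> \<and> log_poisson_pair (\<phi> ratX) (\<phi> ratY) \<and> range \<phi> = A)"

lemma log_rational_UNIV: "log_rational UNIV"
  unfolding log_rational_def log_poisson_pair_def
  by (rule exI[of _ "\<lambda>f. f"]) (simp add: alg_endo_id br_Y_X)

lemma log_rational_iso:
  assumes "log_rational A"
  shows "\<exists>\<phi>. poisson_alg_iso A UNIV \<phi>"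
proof -
  obtain \<phi> where \<phi>: "alg_endo \<phi>" "log_poisson_pair (\<phi> ratX) (\<phi> ratY)" "range \<phi> = A"
    using assms by (auto simp: log_rational_def)
  note br = endo_poisson[OF \<phi>(1,2)]
  have inj: "inj \<phi>" by (rule injI) (simp add: endo_eq_iff[OF \<phi>(1)])
  have inv: "inv_into UNIV \<phi> (\<phi> f) = f" for f using inj by simp
  have sub: "\<phi> f + \<phi> g \<in> A" "\<phi> f * \<phi> g \<in> A" "poisson_br (\<phi> f) (\<phi> g) \<in> A" "ratconst c \<in> A" for f g c
    unfolding \<phi>(3)[symmetric] endo_add[OF \<phi>(1), symmetric] endo_mult[OF \<phi>(1), symmetric] br[symmetric]
    by (rule rangeI, rule rangeI, rule rangeI, metis endo_const[OF \<phi>(1)] rangeI)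
  have "poisson_alg_iso A UNIV (inv_into UNIV \<phi>)"
    unfolding poisson_alg_iso_def poisson_subalgebra_def
  proof (intro conjI)
    show "bij_betw (inv_into UNIV \<phi>) A UNIV"
      using inj \<phi>(3) by (metis bij_betw_imageI bij_betw_inv_into)
    show "\<forall>c. inv_into UNIV \<phi> (ratconst c) = ratconst c"
      using inv endo_const[OF \<phi>(1)] by metis
  qed (use sub in \<open>auto simp: \<phi>(3)[symmetric] inv simp flip: endo_add[OF \<phi>(1)] endo_mult[OF \<phi>(1)] br\<close>)
  then show ?thesis by blast
qed

lemma log_pair_comp:
  assumes \<phi>: "alg_endo \<phi>" "log_poisson_pair (\<phi> ratX) (\<phi> ratY)"
    and \<psi>: "log_poisson_pair (\<psi> ratX) (\<psi> ratY)"
  shows "log_poisson_pair ((\<phi> \<circ> \<psi>) ratX) ((\<phi> \<circ> \<psi>) ratY)"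
  using \<psi> by (simp add: log_poisson_pair_def endo_eq_0_iff[OF \<phi>(1)] endo_mult[OF \<phi>(1)]
      flip: endo_poisson[OF \<phi>])

lemma log_rational_image:
  assumes A: "log_rational A" and \<phi>: "alg_endo \<phi>" "log_poisson_pair (\<phi> ratX) (\<phi> ratY)"
  shows "log_rational (\<phi> ` A)"
proof -
  obtain \<psi> where \<psi>: "alg_endo \<psi>" "log_poisson_pair (\<psi> ratX) (\<psi> ratY)" "range \<psi> = A"
    using A by (auto simp: log_rational_def)
  have "range (\<phi> \<circ> \<psi>) = \<phi> ` A" using \<psi>(3) by auto
  then show ?thesis
    unfolding log_rational_def using alg_endo_comp[OF \<phi>(1) \<psi>(1)] log_pair_comp[OF \<phi> \<psi>(2)] by blast
qed

text \<open>The fixed field of an automorphism \<open>\<rho>\<close> inside an embedded copy of \<open>k(x, y)\<close> is computed upstairs,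
by the automorphism \<open>\<sigma>\<close> that \<open>\<rho>\<close> induces on the new variables.\<close>

lemma tower_fixed:
  assumes \<phi>: "alg_endo \<phi>" and \<rho>: "alg_endo \<rho>" and \<sigma>: "alg_endo \<sigma>"
    and XY: "\<rho> (\<phi> ratX) = \<phi> (\<sigma> ratX)" "\<rho> (\<phi> ratY) = \<phi> (\<sigma> ratY)"
  shows "{f \<in> range \<phi>. \<rho> f = f} = \<phi> ` {f. \<sigma> f = f}"
proof -
  have "\<rho> \<circ> \<phi> = \<phi> \<circ> \<sigma>"
    by (rule alg_endo_ext) (simp_all add: alg_endo_comp \<phi> \<rho> \<sigma> XY)
  then have "\<rho> (\<phi> f) = \<phi> (\<sigma> f)" for f by (simp add: fun_eq_iff)
  then show ?thesis by (auto simp: endo_eq_iff[OF \<phi>])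
qed

lemma finite_sl2_det: "finite_sl2 G \<Longrightarrow> g \<in> G \<Longrightarrow> det g = 1"
  and finite_sl2_mult: "finite_sl2 G \<Longrightarrow> g \<in> G \<Longrightarrow> h \<in> G \<Longrightarrow> g ** h \<in> G"
  by (auto simp: finite_sl2_def)

lemma monomial_aut_values:
  assumes "a * d - b * c = 1"
  shows "alg_endo (monomial_aut (mat2 a b c d))"
    "monomial_aut (mat2 a b c d) ratX = ratY powi b * ratX powi d"
    "monomial_aut (mat2 a b c d) ratY = ratY powi a * ratX powi c"
  using assms by (simp_all add: monomial_aut_endo monomial_aut_X monomial_aut_Y)

lemma inversion_values:
  "alg_endo (monomial_aut (mat2 (- 1) 0 0 (- 1)) :: 'a::field ratfun2 \<Rightarrow> _)"
  "monomial_aut (mat2 (- 1) 0 0 (- 1)) (ratX :: 'a ratfun2) = 1 / ratX"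
  "monomial_aut (mat2 (- 1) 0 0 (- 1)) (ratY :: 'a ratfun2) = 1 / ratY"
  by (simp_all add: monomial_aut_values power_int_minus inverse_eq_divide)

lemma quarter_turn_values:
  "alg_endo (monomial_aut (mat2 0 (- 1) 1 0) :: 'a::field ratfun2 \<Rightarrow> _)"
  "monomial_aut (mat2 0 (- 1) 1 0) (ratX :: 'a::field ratfun2) = 1 / ratY"
  "monomial_aut (mat2 0 (- 1) 1 0) (ratY :: 'a::field ratfun2) = ratX"
  by (simp_all add: monomial_aut_values power_int_minus inverse_eq_divide)

lemma order3_values:
  "alg_endo (monomial_aut (mat2 0 (- 1) 1 (- 1)) :: 'a::field ratfun2 \<Rightarrow> _)"
  "monomial_aut (mat2 0 (- 1) 1 (- 1)) (ratX :: 'a ratfun2) = 1 / (ratX * ratY)"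
  "monomial_aut (mat2 0 (- 1) 1 (- 1)) (ratY :: 'a ratfun2) = ratX"
  by (simp_all add: monomial_aut_values power_int_minus inverse_eq_divide)

lemma log_rational_inversion:
  "log_rational {f :: 'a::field_char_0 ratfun2. monomial_aut (mat2 (- 1) 0 0 (- 1)) f = f}"
proof (rule order2_generators[where 'a = 'a])
  fix \<phi> :: "'a ratfun2 \<Rightarrow> 'a ratfun2"
  assume \<phi>: "alg_endo \<phi>" "log_poisson_pair (\<phi> ratX) (\<phi> ratY)"
    and "\<And>\<sigma> f. alg_endo \<sigma> \<Longrightarrow> \<sigma> ratX = 1 / ratX \<Longrightarrow> \<sigma> ratY = 1 / ratY \<Longrightarrow> \<sigma> f = f \<longleftrightarrow> f \<in> range \<phi>"
  from this(3)[OF inversion_values]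
  have "{f. monomial_aut (mat2 (- 1) 0 0 (- 1)) f = f} = range \<phi>" by blast
  then show ?thesis unfolding log_rational_def using \<phi> by metis
qed

text \<open>The square of the quarter turn is the inversion, so its fixed field lies in that of the inversion,
on whose generators the quarter turn acts as the twisted involution.\<close>

lemma log_rational_quarter_turn:
  "log_rational {f :: 'a::field_char_0 ratfun2. monomial_aut (mat2 0 (- 1) 1 0) f = f}"
proof (rule order2_generators[where 'a = 'a], rule twisted_involution_generators[where 'a = 'a])
  fix \<phi> \<psi> :: "'a ratfun2 \<Rightarrow> 'a ratfun2"
  let ?\<rho> = "monomial_aut (mat2 0 (- 1) 1 0) :: 'a ratfun2 \<Rightarrow> 'a ratfun2"
  assume \<phi>: "alg_endo \<phi>" "log_poisson_pair (\<phi> ratX) (\<phi> ratY)"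
    "\<phi> ratX = ratX * (ratY - 1) ^ 2 / (ratY * (ratX - 1) ^ 2)"
    "\<phi> ratY = (ratX - ratY) / (ratX * ratY - 1)"
    and \<phi>_fix: "\<And>\<sigma> f. alg_endo \<sigma> \<Longrightarrow> \<sigma> ratX = 1 / ratX \<Longrightarrow> \<sigma> ratY = 1 / ratY \<Longrightarrow> \<sigma> f = f \<longleftrightarrow> f \<in> range \<phi>"
    and \<psi>: "alg_endo \<psi>" "log_poisson_pair (\<psi> ratX) (\<psi> ratY)"
    and \<psi>_fix: "\<And>\<sigma> f. alg_endo \<sigma> \<Longrightarrow> \<sigma> ratX = 1 / ratX \<Longrightarrow> \<sigma> ratY = - 1 / ratY \<Longrightarrow> \<sigma> f = f \<longleftrightarrow> f \<in> range \<psi>"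
  note \<rho> = quarter_turn_values[where 'a = 'a]
  have "log_poisson_pair (1 / ratX :: 'a ratfun2) (- 1 / ratY)"
    unfolding log_poisson_pair_def br_theta
    by (simp add: deriv_divide[OF derivation_theta_x] deriv_divide[OF derivation_theta_y]
        theta_x_simps theta_y_simps power2_eq_square)
  then obtain \<sigma> :: "'a ratfun2 \<Rightarrow> 'a ratfun2" where
    \<sigma>: "alg_endo \<sigma>" "\<sigma> ratX = 1 / ratX" "\<sigma> ratY = - 1 / ratY"
    by (rule log_poisson_pair_substitution)
  have square: "mat2 0 (- 1) 1 0 ** mat2 0 (- 1) 1 0 = mat2 (- 1) 0 0 (- 1)" by simp
  have \<rho>\<rho>: "?\<rho> (?\<rho> f) = monomial_aut (mat2 (- 1) 0 0 (- 1)) f" for f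
    unfolding square[symmetric] by (rule monomial_aut_mult[symmetric]) simp_all
  have "f \<in> range \<phi>" if "?\<rho> f = f" for f
  proof -
    have "monomial_aut (mat2 (- 1) 0 0 (- 1)) f = f" using \<rho>\<rho>[of f] that by simp
    then show ?thesis using \<phi>_fix[OF inversion_values] by blast
  qed
  then have "{f. ?\<rho> f = f} = {f \<in> range \<phi>. ?\<rho> f = f}" by blast
  also have "\<dots> = \<phi> ` {f. \<sigma> f = f}"
  proof (rule tower_fixed[OF \<phi>(1) \<rho>(1) \<sigma>(1)])
    have nz: "(ratX :: 'a ratfun2) - 1 \<noteq> 0" "(ratY :: 'a ratfun2) - 1 \<noteq> 0"
        "(ratX :: 'a ratfun2) - ratY \<noteq> 0" "(ratX :: 'a ratfun2) * ratY - 1 \<noteq> 0"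
      using generator_nz1[where 'a = 'a] ratX_neq_ratY[where 'a = 'a] by simp_all
    show "?\<rho> (\<phi> ratX) = \<phi> (\<sigma> ratX)" "?\<rho> (\<phi> ratY) = \<phi> (\<sigma> ratY)"
      unfolding \<sigma>(2,3) endo_simps[OF \<phi>(1)] unfolding \<phi>(3,4) endo_simps[OF \<rho>(1)] \<rho>(2,3)
      using nz by (simp_all add: divide_simps) (algebra+)
  qed
  also have "{f. \<sigma> f = f} = range \<psi>" using \<psi>_fix[OF \<sigma>] by blast
  finally have "{f. ?\<rho> f = f} = \<phi> ` range \<psi>" .
  moreover have "log_rational (range \<psi>)" using \<psi> by (auto simp: log_rational_def)
  ultimately show ?thesis using log_rational_image[OF _ \<phi>(1,2)] by simp
qed

text \<open>The second fixed field belongs to the cyclic group of order six. The generators for order three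
are inverted by \<open>\<tau>\<close>, so the case of the inversion applies once more.\<close>

lemma log_rational_order3:
  fixes \<omega> :: "'a::field_char_0"
  assumes \<omega>: "primitive_root_of_unity 3 \<omega>"
  defines "\<sigma> \<equiv> monomial_aut (mat2 0 (- 1) 1 (- 1)) :: 'a ratfun2 \<Rightarrow> 'a ratfun2"
    and "\<tau> \<equiv> monomial_aut (mat2 (- 1) 0 0 (- 1)) :: 'a ratfun2 \<Rightarrow> 'a ratfun2"
  shows "log_rational {f. \<sigma> f = f}" "log_rational {f. \<sigma> f = f \<and> \<tau> f = f}"
proof -
  obtain \<phi> :: "'a ratfun2 \<Rightarrow> 'a ratfun2" where \<phi>: "alg_endo \<phi>" "log_poisson_pair (\<phi> ratX) (\<phi> ratY)"
    and \<phi>_fix: "\<And>\<sigma> f. alg_endo \<sigma> \<Longrightarrow> \<sigma> ratX = 1 / (ratX * ratY) \<Longrightarrow> \<sigma> ratY = ratX \<Longrightarrow> \<sigma> f = f \<longleftrightarrow> f \<in> range \<phi>"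
    and \<phi>_inv: "\<And>\<tau>. alg_endo \<tau> \<Longrightarrow> \<tau> ratX = 1 / ratX \<Longrightarrow> \<tau> ratY = 1 / ratY \<Longrightarrow>
       \<tau> (\<phi> ratX) = 1 / \<phi> ratX \<and> \<tau> (\<phi> ratY) = 1 / \<phi> ratY"
    by (rule order3_generators[OF \<omega>], rule that) blast+
  have fixed: "{f. \<sigma> f = f} = range \<phi>"
    using \<phi>_fix[OF order3_values] unfolding \<sigma>_def by blast
  then show "log_rational {f. \<sigma> f = f}" using \<phi> by (auto simp: log_rational_def)
  note \<tau> = inversion_values[where 'a = 'a, folded \<tau>_def]
  have "{f. \<sigma> f = f \<and> \<tau> f = f} = {f \<in> range \<phi>. \<tau> f = f}" using fixed by blast
  also have "\<dots> = \<phi> ` {f. \<tau> f = f}"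
    by (rule tower_fixed[OF \<phi>(1) \<tau>(1) \<tau>(1)]) (use \<phi>_inv[OF \<tau>] \<tau> in \<open>simp_all add: endo_simps[OF \<phi>(1)]\<close>)
  finally show "log_rational {f. \<sigma> f = f \<and> \<tau> f = f}"
    using log_rational_image[OF log_rational_inversion \<phi>] by (simp add: \<tau>_def)
qed

text \<open>Conjugate groups have fixed fields that correspond under a monomial automorphism, which is a
Poisson automorphism.\<close>

lemma finite_sl2_conj:
  assumes G: "finite_sl2 G" and h: "det h = 1"
  obtains H where "finite_sl2 H" "\<And>g g'. g \<in> G \<Longrightarrow> h ** g = g' ** h \<Longrightarrow> g' \<in> H"
    "log_rational (fixed_field H :: 'a::field ratfun2 set) \<Longrightarrow> log_rational (fixed_field G :: 'a ratfun2 set)"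
proof -
  obtain a b c d where abcd: "h = mat2 a b c d" by (rule mat2_cases)
  define k where "k = mat2 d (- b) (- c) a"
  have kh: "k ** h = mat 1" and hk: "h ** k = mat 1" and k: "det k = 1"
    using h by (simp_all add: k_def abcd mat_1_mat2 algebra_simps)
  define H where "H = (\<lambda>g. h ** g ** k) ` G"
  have commute: "(h ** g ** k) ** h = h ** g" for g
  proof -
    have "(h ** g ** k) ** h = (h ** g) ** (k ** h)" by (simp only: matrix_mul_assoc)
    then show ?thesis by (simp add: kh)
  qed
  show ?thesis
  proof (rule that[of H])
    have mult: "(h ** g ** k) ** (h ** g' ** k) = h ** (g ** g') ** k" for g g'
    proof -
      have "(h ** g ** k) ** (h ** g' ** k) = ((h ** g ** k) ** h) ** g' ** k"
        by (simp only: matrix_mul_assoc)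
      then show ?thesis unfolding commute by (simp only: matrix_mul_assoc)
    qed
    have "mat 1 = h ** mat 1 ** k" by (simp add: hk)
    moreover have "mat 1 \<in> G" "finite G" using G by (simp_all add: finite_sl2_def)
    ultimately have "mat 1 \<in> H" "finite H" unfolding H_def by blast+
    moreover have "det (h ** g ** k) = 1" if "g \<in> G" for g
      using h k finite_sl2_det[OF G that] by (simp add: det_mul)
    moreover have "(h ** g ** k) ** (h ** g' ** k) \<in> H" if "g \<in> G" "g' \<in> G" for g g'
      unfolding mult H_def using finite_sl2_mult[OF G that] by blast
    ultimately show "finite_sl2 H" unfolding finite_sl2_def by (auto simp: H_def)
  next
    fix g g' assume "g \<in> G" "h ** g = g' ** h"
    then have "h ** g ** k = g' ** (h ** k)" by (simp only: matrix_mul_assoc)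
    then have "g' = h ** g ** k" by (simp add: hk)
    then show "g' \<in> H" using \<open>g \<in> G\<close> by (simp add: H_def)
  next
    let ?m = "monomial_aut h :: 'a ratfun2 \<Rightarrow> 'a ratfun2" and ?n = "monomial_aut k :: 'a ratfun2 \<Rightarrow> 'a ratfun2"
    have endo: "alg_endo ?m" "alg_endo ?n" using h k by (simp_all add: monomial_aut_endo)
    have nm: "?n (?m f) = f" and mn: "?m (?n f) = f" for f
      using h k by (simp_all add: kh hk monomial_aut_1 flip: monomial_aut_mult)
    have "?m f \<in> fixed_field H \<longleftrightarrow> f \<in> fixed_field G" for f
    proof -
      have "monomial_aut (h ** g ** k) (?m f) = ?m (monomial_aut g f)" if "g \<in> G" for g
      proof -
        have "det g = 1" using G that by (rule finite_sl2_det)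
        then show ?thesis using h k by (simp add: commute det_mul flip: monomial_aut_mult)
      qed
      then show ?thesis by (auto simp: fixed_field_def H_def endo_eq_iff[OF endo(1)])
    qed
    then have "?n ` fixed_field H = fixed_field G"
      using nm mn by (auto simp: image_iff) metis+
    then show "log_rational (fixed_field H :: 'a ratfun2 set) \<Longrightarrow> log_rational (fixed_field G :: 'a ratfun2 set)"
      using log_rational_image[OF _ endo(2) monomial_aut_pair[OF k], of "fixed_field H"] by simp
  qed
qed

text \<open>If none of \<open>g\<close>, \<open>S g\<close>, \<open>S^2 g\<close> were scalar, all three would have traces of absolute value at most
\<open>1\<close>, being elements of \<open>G\<close>, against the trace bound. So \<open>S\<close> and the scalar matrices in \<open>G\<close> generate \<open>G\<close>.\<close>

lemma companion_group:
  assumes G: "finite_sl2 G" and S: "mat2 0 (- 1) 1 t \<in> G" and t: "\<bar>t\<bar> \<le> 1" and g: "g \<in> G"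
  shows "\<exists>i\<le>2. \<exists>e\<in>{1, - 1}. ((**) (mat2 0 (- 1) 1 t) ^^ i) g = mat2 e 0 0 e"
proof -
  obtain p q r s where pqrs: "g = mat2 p q r s" by (rule mat2_cases)
  let ?S = "mat2 0 (- 1) 1 t"
  have Sg: "?S ** g = mat2 (- r) (- s) (p + t * r) (q + t * s)" by (simp add: pqrs)
  have SSg: "?S ** (?S ** g) = mat2 (- p - t * r) (- q - t * s) (- r + t * (p + t * r)) (- s + t * (q + t * s))"
    by (simp add: pqrs)
  have in_G: "g \<in> G" "?S ** g \<in> G" "?S ** (?S ** g) \<in> G"
    using finite_sl2_mult[OF G S] g by auto
  have det: "p * s - q * r = 1" using finite_sl2_det[OF G g] by (simp add: pqrs)
  have scalar: "\<bar>a + d\<bar> \<le> 1" if "mat2 a b c d \<in> G" "\<not> (\<exists>e\<in>{1, - 1}. mat2 a b c d = mat2 e 0 0 e)" for a b c d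
    using finite_sl2_elements[OF G that(1)] that(2) by blast
  have "\<exists>e\<in>{1, - 1}. g = mat2 e 0 0 e \<or> ?S ** g = mat2 e 0 0 e \<or> ?S ** (?S ** g) = mat2 e 0 0 e"
  proof (rule ccontr)
    assume no: "\<not> ?thesis"
    have "\<bar>p + s\<bar> \<le> 1" using scalar[of p q r s] in_G(1) no unfolding pqrs by blast
    moreover have "\<bar>- r + (q + t * s)\<bar> \<le> 1" using scalar in_G(2) no unfolding Sg by blast
    moreover have "\<bar>(- p - t * r) + (- s + t * (q + t * s))\<bar> \<le> 1" using scalar in_G(3) no unfolding SSg by blast
    ultimately show False
      using companion_power_bound[OF det t] by (simp add: algebra_simps)
  qed
  then obtain e where e: "e \<in> {1, - 1}"
    and "g = mat2 e 0 0 e \<or> ?S ** g = mat2 e 0 0 e \<or> ?S ** (?S ** g) = mat2 e 0 0 e" by blast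
  then have "((**) ?S ^^ 0) g = mat2 e 0 0 e \<or> ((**) ?S ^^ 1) g = mat2 e 0 0 e \<or> ((**) ?S ^^ 2) g = mat2 e 0 0 e"
    by (simp add: numeral_2_eq_2)
  then show ?thesis using e by (metis le0 one_le_numeral order_refl)
qed

text \<open>Every element of \<open>G\<close> becomes a scalar after multiplication by a power of the companion matrix.\<close>

lemma companion_fixed_field:
  assumes G: "finite_sl2 G" and S: "mat2 0 (- 1) 1 t \<in> G" and t: "\<bar>t\<bar> \<le> 1"
  shows "fixed_field G = {f :: 'a::field ratfun2. monomial_aut (mat2 0 (- 1) 1 t) f = f \<and>
    (mat2 (- 1) 0 0 (- 1) \<in> G \<longrightarrow> monomial_aut (mat2 (- 1) 0 0 (- 1)) f = f)}" (is "_ = ?R")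
proof
  show "fixed_field G \<subseteq> ?R" using S by (auto simp: fixed_field_def)
  show "?R \<subseteq> fixed_field G"
  proof
    fix f :: "'a ratfun2" assume f: "f \<in> ?R"
    let ?S = "mat2 0 (- 1) 1 t"
    have Sf: "monomial_aut ?S f = f" using f by simp
    note endo = monomial_aut_endo[of ?S, where 'a = 'a]
    show "f \<in> fixed_field G"
    proof (rule fixed_fieldI)
      fix g assume g: "g \<in> G"
      have iter: "((**) ?S ^^ i) g \<in> G \<and>
          (monomial_aut (((**) ?S ^^ i) g) f = f \<longrightarrow> monomial_aut g f = f)" for i
      proof (induction i)
        case (Suc i)
        let ?g = "((**) ?S ^^ i) g"
        have "det ?g = 1" using finite_sl2_det[OF G] Suc by blast
        then have "monomial_aut (?S ** ?g) f = monomial_aut ?S (monomial_aut ?g f)"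
          by (intro monomial_aut_mult) simp_all
        moreover have "monomial_aut ?S (monomial_aut ?g f) = monomial_aut ?S f \<longleftrightarrow> monomial_aut ?g f = f"
          by (rule endo_eq_iff) (simp add: monomial_aut_endo)
        ultimately show ?case using Suc finite_sl2_mult[OF G S] Sf by simp
      qed (simp add: g)
      obtain i e where e: "e \<in> {1, - 1}" "((**) ?S ^^ i) g = mat2 e 0 0 e"
        using companion_group[OF G S t g] by blast
      have "monomial_aut (mat2 e 0 0 e) f = f"
      proof (cases "e = 1")
        case True
        then show ?thesis using monomial_aut_1[of f] by (simp add: mat_1_mat2)
      next
        case False
        then show ?thesis using f e iter[of i] by auto
      qed
      then show "monomial_aut g f = f" using iter[of i] e by simp
    qed
  qed
qed

lemma log_rational_companion:
  fixes \<omega> :: "'a::field_char_0"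
  assumes \<omega>: "primitive_root_of_unity 3 \<omega>"
    and G: "finite_sl2 G" and S: "mat2 0 (- 1) 1 t \<in> G" and t: "t = 0 \<or> t = - 1"
  shows "log_rational (fixed_field G :: 'a ratfun2 set)"
  using t
proof
  assume t: "t = 0"
  let ?S = "mat2 0 (- 1) 1 0"
  have "monomial_aut (mat2 (- 1) 0 0 (- 1)) f = f" if "monomial_aut ?S f = f" for f :: "'a ratfun2"
    using monomial_aut_mult[of ?S ?S f] that by simp
  then have "fixed_field G = {f :: 'a ratfun2. monomial_aut ?S f = f}"
    using companion_fixed_field[OF G S, where 'a = 'a] t by auto
  then show ?thesis using log_rational_quarter_turn[where 'a = 'a] by simp
next
  assume t: "t = - 1"
  then have "fixed_field G = {f :: 'a ratfun2. monomial_aut (mat2 0 (- 1) 1 (- 1)) f = f \<and>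
    (mat2 (- 1) 0 0 (- 1) \<in> G \<longrightarrow> monomial_aut (mat2 (- 1) 0 0 (- 1)) f = f)}"
    using companion_fixed_field[OF G S, where 'a = 'a] by simp
  then show ?thesis
    using log_rational_order3[OF \<omega>] by (cases "mat2 (- 1) 0 0 (- 1) \<in> G") simp_all
qed

text \<open>For \<open>e = - 1\<close> the element \<open>g\<close> is conjugate to the inverse of a companion matrix, so a power of \<open>g\<close>
serves instead: the third power for \<open>t = 0\<close>, and for \<open>t = - 1\<close> the second power, which one more
shear conjugates to the companion matrix.\<close>

lemma log_rational_conj_companion:
  fixes \<omega> :: "'a::field_char_0"
  assumes \<omega>: "primitive_root_of_unity 3 \<omega>" and G: "finite_sl2 G" and g: "g \<in> G"
    and conj: "sl2_conj g (mat2 0 (- e) e t)" and e: "e \<in> {1, - 1}" and t: "t = 0 \<or> t = - 1"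
  shows "log_rational (fixed_field G :: 'a ratfun2 set)"
proof -
  have pos: "log_rational (fixed_field K :: 'a ratfun2 set)"
    if K: "finite_sl2 K" "k \<in> K" and conj: "sl2_conj k (mat2 0 (- 1) 1 t)" for K k
  proof -
    obtain h where h: "det h = 1" "h ** k = mat2 0 (- 1) 1 t ** h"
      using conj by (auto simp: sl2_conj_def)
    obtain H where H: "finite_sl2 H" "\<And>g g'. g \<in> K \<Longrightarrow> h ** g = g' ** h \<Longrightarrow> g' \<in> H"
      "log_rational (fixed_field H :: 'a ratfun2 set) \<Longrightarrow> log_rational (fixed_field K :: 'a ratfun2 set)"
      by (rule finite_sl2_conj[OF K(1) h(1), where 'a = 'a]) blast
    show ?thesis by (rule H(3), rule log_rational_companion[OF \<omega> H(1) H(2)[OF K(2) h(2)] t])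
  qed
  show ?thesis
  proof (cases "e = 1")
    case True
    then show ?thesis using pos[OF G g] conj by simp
  next
    case False
    then have e: "e = - 1" using e by simp
    obtain h where h: "det h = 1" "h ** g = mat2 0 1 (- 1) t ** h"
      using conj e by (auto simp: sl2_conj_def)
    obtain H where H: "finite_sl2 H" "\<And>g g'. g \<in> G \<Longrightarrow> h ** g = g' ** h \<Longrightarrow> g' \<in> H"
      "log_rational (fixed_field H :: 'a ratfun2 set) \<Longrightarrow> log_rational (fixed_field G :: 'a ratfun2 set)"
      by (rule finite_sl2_conj[OF G h(1), where 'a = 'a]) blast
    have S: "mat2 0 1 (- 1) t \<in> H" by (rule H(2)[OF g h(2)])
    note SS = finite_sl2_mult[OF H(1) S S]
    have "\<exists>k\<in>H. sl2_conj k (mat2 0 (- 1) 1 t)"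
      using t
    proof
      assume "t = 0"
      then have "mat2 0 (- 1) 1 0 \<in> H" using finite_sl2_mult[OF H(1) S SS] by simp
      moreover have "sl2_conj (mat2 0 (- 1) 1 0) (mat2 0 (- 1) 1 0)"
        unfolding sl2_conj_def by (rule exI[of _ "mat2 1 0 0 1"]) simp
      ultimately show ?thesis using \<open>t = 0\<close> by blast
    next
      assume "t = - 1"
      then have "mat2 (- 1) (- 1) 1 0 \<in> H" using SS by simp
      then show ?thesis using sl2_conj_companion_unit[of "- 1" 0 "- 1" 1] \<open>t = - 1\<close> by auto
    qed
    then show ?thesis using H(1,3) pos by blast
  qed
qed

text \<open>An element of trace \<open>1\<close> has a square of trace \<open>- 1\<close>, so companion matrices of trace \<open>0\<close> and \<open>- 1\<close>
cover all groups with a non-scalar element.\<close>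

lemma log_rational_fixed_field:
  fixes \<omega> :: "'a::field_char_0"
  assumes \<omega>: "primitive_root_of_unity 3 \<omega>" and G: "finite_sl2 G"
  shows "log_rational (fixed_field G :: 'a ratfun2 set)"
proof (cases "\<forall>g\<in>G. g = mat 1 \<or> g = mat2 (- 1) 0 0 (- 1)")
  case True
  show ?thesis
  proof (cases "mat2 (- 1) 0 0 (- 1) \<in> G")
    case inv: True
    then have "fixed_field G = {f :: 'a ratfun2. monomial_aut (mat2 (- 1) 0 0 (- 1)) f = f}"
      using True by (auto simp: fixed_field_def monomial_aut_1)
    then show ?thesis using log_rational_inversion[where 'a = 'a] by simp
  next
    case False
    then have "fixed_field G = (UNIV :: 'a ratfun2 set)"
      using True by (auto simp: fixed_field_def monomial_aut_1)
    then show ?thesis by (simp add: log_rational_UNIV)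
  qed
next
  case False
  then obtain g where g: "g \<in> G" "g \<noteq> mat 1" "g \<noteq> mat2 (- 1) 0 0 (- 1)" by blast
  obtain a b c d where abcd: "g = mat2 a b c d" by (rule mat2_cases)
  have bound: "\<bar>a + d\<bar> \<le> 1"
    using finite_sl2_elements[OF G, of a b c d] g unfolding mat_1_mat2 abcd by blast
  have det: "a * d - b * c = 1" using finite_sl2_det[OF G g(1)] by (simp add: abcd)
  have key: "log_rational (fixed_field G :: 'a ratfun2 set)"
    if "mat2 p q r s \<in> G" "p + s = 0 \<or> p + s = - 1" for p q r s
  proof -
    have "p * s - q * r = 1" using finite_sl2_det[OF G that(1)] by simp
    moreover have "\<bar>p + s\<bar> \<le> 1" using that(2) by auto
    ultimately obtain e where "e \<in> {1, -1}" "sl2_conj (mat2 p q r s) (mat2 0 (- e) e (p + s))"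
      using sl2_conj_companion by blast
    then show ?thesis using log_rational_conj_companion[OF \<omega> G that(1)] that(2) by blast
  qed
  show ?thesis
  proof (cases "a + d = 1")
    case True
    have "mat2 (a * a + b * c) (a * b + b * d) (c * a + d * c) (c * b + d * d) \<in> G"
      using finite_sl2_mult[OF G g(1) g(1)] by (simp add: abcd)
    moreover have "a * a + b * c + (c * b + d * d) = - 1"
    proof -
      have "a * a + b * c + (c * b + d * d) = (a + d) * (a + d) - 2 * (a * d - b * c)"
        by (simp add: algebra_simps)
      then show ?thesis unfolding True det by simp
    qed
    ultimately show ?thesis using key by blast
  next
    case False
    then have "a + d = 0 \<or> a + d = - 1" using bound by linarith
    then show ?thesis using key g(1) abcd by blast
  qed
qed

lemma finite_sl2_of_subgroup:
  assumes "subgroup G SL2Z" "finite G"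
  shows "finite_sl2 G"
  using assms subgroup.subset[OF assms(1)] subgroup.m_closed[OF assms(1)] subgroup.one_closed[OF assms(1)]
  by (auto simp: finite_sl2_def SL2Z_def)

theorem theorem1p3p8:
  fixes \<omega> :: "'a::field_char_0" and G :: "(int^2^2) set"
  assumes "primitive_root_of_unity 3 \<omega>"
    and "subgroup G SL2Z" and "finite G"
  shows "\<exists>\<phi> :: 'a ratfun2 \<Rightarrow> 'a ratfun2. poisson_alg_iso (fixed_field G) UNIV \<phi>"
  using assms by (intro log_rational_iso log_rational_fixed_field finite_sl2_of_subgroup)

end
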